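(* Let $(p_{ij} \colon X_j \to X_i)_{i \sqsubseteq j \in I}$ be a projective system of topological spaces, with canonical projective limit $X, (p_i)_{i \in I}$. If every $X_i$ is sober, if $\iota_X$ is surjective, and if $\mathcal H_{\mathsf V} X$ (with the maps $\mathcal H_{\mathsf V}\, p_i$) is a projective limit of $(\mathcal H_{\mathsf V}\, p_{ij} \colon \mathcal H_{\mathsf V} X_j \to \mathcal H_{\mathsf V} X_i)_{i \sqsubseteq j \in I}$, then $\mathcal{P}\ell_{\mathcal V} X$ (with the maps $\mathcal{P}\ell_{\mathcal V}\, p_i$) is a projective limit of $(\mathcal{P}\ell_{\mathcal V}\, p_{ij} \colon \mathcal{P}\ell_{\mathcal V} X_j \to \mathcal{P}\ell_{\mathcal V} X_i)_{i \sqsubseteq j \in I}$.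
   Context: **Topology.** $\mathcal O X$ is the lattice of open subsets of $X$. The specialization preordering is: $x \leq y$ iff every open neighborhood of $x$ contains $y$; $\uparrow A$ denotes upward closure, $cl(A)$ topological closure, $f[A]$ direct image. A subset is saturated iff it is upwards-closed. Compactness is the open cover property, with no separation axiom. A space is sober iff it is $T_0$ and every irreducible closed subset is the closure of a point. **Projective systems.** A projective system $(p_{ij} \colon X_j \to X_i)_{i \sqsubseteq j \in I}$ consists of a directed preordered set $(I,\sqsubseteq)$, spaces $X_i$, and continuous maps $p_{ij}$ ($i \sqsubseteq j$) with $p_{ii} = \mathrm{id}$ and $p_{ij} \circ p_{jk} = p_{ik}$ for $i \sqsubseteq j \sqsubseteq k$. Its canonical projective limit is $X = \{\vec x \in \prod_{i} X_i \mid p_{ij}(x_j) = x_i \text{ for all } i \sqsubseteq j\}$ with the subspace topology of the product, $p_i$ being projection onto coordinate $i$. Saying that $Y$ with maps $(q_i)_{i\in I}$ is a projective limit of a projective system with canonical limit $Z$ means that the map $y \mapsto (q_i(y))_{i \in I}$ is a (well-defined) homeomorphism from $Y$ onto $Z$. **Functors and $\iota_X$.** - $\mathcal H_{\mathsf V} X$: the set of non-empty closed subsets of $X$, with topology generated by $\{C \mid C \cap U \neq \emptyset\}$, $U \in \mathcal O X$; a continuous map $f \colon X \to Y$ acts by $C \mapsto cl(f[C])$. - $\mathcal{P}\ell_{\mathcal V} X$: the set of lenses of $X$, i.e., non-empty sets of the form $Q \cap C$ with $Q$ compact saturated and $C$ closed, with the Vietoris topology generated by $\Box U = \{L \mid L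 \subseteq U\}$ and $\Diamond U = \{L \mid L \cap U \neq \emptyset\}$, $U \in \mathcal O X$. A continuous map $f$ acts by $L \mapsto \uparrow f[L] \cap cl(f[L])$. - $\mathcal P^{\mathrm q}_{\mathsf V} X$: the space of quasi-lenses on $X$, i.e., pairs $(Q,C)$ of a compact saturated subset $Q$ and a closed subset $C$ of $X$ such that (1) $Q \cap C \neq \emptyset$; (2) $Q \subseteq \uparrow(Q \cap C)$; (3) for every open neighborhood $U$ of $Q$, $C \subseteq cl(U \cap C)$; its topology is generated by the sets $\{(Q,C) \mid Q \subseteq U\}$ and $\{(Q,C) \mid C \cap U \neq \emptyset\}$, $U \in \mathcal O X$. - $\iota_X \colon \mathcal{P}\ell_{\mathcal V} X \to \mathcal P^{\mathrm q}_{\mathsf V} X$ is the (well-defined) map $L \mapsto (\uparrow L, cl(L))$. *)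

theory Defs
  imports "HOL-Analysis.Analysis"
begin

section \<open>Specialization preordering, saturation, sobriety\<close>

definition spec_le :: "'a topology \<Rightarrow> 'a \<Rightarrow> 'a \<Rightarrow> bool" where
  "spec_le X x y \<longleftrightarrow> x \<in> topspace X \<and> y \<in> topspace X \<and> (\<forall>U. openin X U \<and> x \<in> U \<longrightarrow> y \<in> U)"

definition up_closure :: "'a topology \<Rightarrow> 'a set \<Rightarrow> 'a set" where
  "up_closure X A = {y. \<exists>x\<in>A. spec_le X x y}"

definition saturated_in :: "'a topology \<Rightarrow> 'a set \<Rightarrow> bool" where
  "saturated_in X A \<longleftrightarrow> A \<subseteq> topspace X \<and> (\<forall>x\<in>A. \<forall>y. spec_le X x y \<longrightarrow> y \<in> A)"

definition irreducible_closed_in :: "'a topology \<Rightarrow> 'a set \<Rightarrow> bool" where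
  "irreducible_closed_in X C \<longleftrightarrow> closedin X C \<and> C \<noteq> {} \<and>
     (\<forall>A B. closedin X A \<and> closedin X B \<and> C \<subseteq> A \<union> B \<longrightarrow> C \<subseteq> A \<or> C \<subseteq> B)"

definition sober_space :: "'a topology \<Rightarrow> bool" where
  "sober_space X \<longleftrightarrow> t0_space X \<and>
     (\<forall>C. irreducible_closed_in X C \<longrightarrow> (\<exists>x\<in>topspace X. C = X closure_of {x}))"


section \<open>Projective systems and limits\<close>

text \<open>
  All spaces of a system are carried by one type; since carriers are arbitrary subsets of
  that type, this is no restriction (use a disjoint union).  The bonding map \<open>p i j\<close> goes
  from \<open>X j\<close> to \<open>X i\<close>, and only its values on \<open>topspace (X j)\<close> matter.  As usual,
  directed includes non-empty.
\<close>

definition projective_system ::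
  "'i set \<Rightarrow> ('i \<Rightarrow> 'i \<Rightarrow> bool) \<Rightarrow> ('i \<Rightarrow> 'a topology) \<Rightarrow> ('i \<Rightarrow> 'i \<Rightarrow> 'a \<Rightarrow> 'a) \<Rightarrow> bool" where
  "projective_system I le X p \<longleftrightarrow>
     reflp_on I le \<and> transp_on I le \<and>
     I \<noteq> {} \<and> (\<forall>i\<in>I. \<forall>j\<in>I. \<exists>k\<in>I. le i k \<and> le j k) \<and>
     (\<forall>i\<in>I. \<forall>j\<in>I. le i j \<longrightarrow> continuous_map (X j) (X i) (p i j)) \<and>
     (\<forall>i\<in>I. \<forall>x\<in>topspace (X i). p i i x = x) \<and>
     (\<forall>i\<in>I. \<forall>j\<in>I. \<forall>k\<in>I. le i j \<and> le j k \<longrightarrow>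
        (\<forall>x\<in>topspace (X k). p i j (p j k x) = p i k x))"

definition projective_limit ::
  "'i set \<Rightarrow> ('i \<Rightarrow> 'i \<Rightarrow> bool) \<Rightarrow> ('i \<Rightarrow> 'a topology) \<Rightarrow> ('i \<Rightarrow> 'i \<Rightarrow> 'a \<Rightarrow> 'a)
    \<Rightarrow> ('i \<Rightarrow> 'a) topology" where
  "projective_limit I le X p =
     subtopology (product_topology X I) {x. \<forall>i\<in>I. \<forall>j\<in>I. le i j \<longrightarrow> p i j (x j) = x i}"

text \<open>Meaningful when \<open>(X, p)\<close> is a projective system.\<close>

definition is_projective_limit ::
  "'i set \<Rightarrow> ('i \<Rightarrow> 'i \<Rightarrow> bool) \<Rightarrow> ('i \<Rightarrow> 'a topology) \<Rightarrow> ('i \<Rightarrow> 'i \<Rightarrow> 'a \<Rightarrow> 'a)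
    \<Rightarrow> 'b topology \<Rightarrow> ('i \<Rightarrow> 'b \<Rightarrow> 'a) \<Rightarrow> bool" where
  "is_projective_limit I le X p Y q \<longleftrightarrow>
     homeomorphic_map Y (projective_limit I le X p) (\<lambda>y. \<lambda>i\<in>I. q i y)"


section \<open>Hyperspaces\<close>

text \<open>The carrier of each of the topologies below is the union of its subbase.\<close>

definition hoare_space :: "'a topology \<Rightarrow> 'a set topology" where
  "hoare_space X =
     topology_generated_by {{C. closedin X C \<and> C \<noteq> {} \<and> C \<inter> U \<noteq> {}} | U. openin X U}"

definition hoare_map :: "'b topology \<Rightarrow> ('a \<Rightarrow> 'b) \<Rightarrow> 'a set \<Rightarrow> 'b set" where
  "hoare_map Y f C = Y closure_of (f ` C)"

definition lenses :: "'a topology \<Rightarrow> 'a set set" where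
  "lenses X = {Q \<inter> C | Q C. compactin X Q \<and> saturated_in X Q \<and> closedin X C \<and> Q \<inter> C \<noteq> {}}"

definition lens_space :: "'a topology \<Rightarrow> 'a set topology" where
  "lens_space X = topology_generated_by
     ({{L \<in> lenses X. L \<subseteq> U} | U. openin X U} \<union> {{L \<in> lenses X. L \<inter> U \<noteq> {}} | U. openin X U})"

definition lens_map :: "'b topology \<Rightarrow> ('a \<Rightarrow> 'b) \<Rightarrow> 'a set \<Rightarrow> 'b set" where
  "lens_map Y f L = up_closure Y (f ` L) \<inter> Y closure_of (f ` L)"

definition quasi_lenses :: "'a topology \<Rightarrow> ('a set \<times> 'a set) set" where
  "quasi_lenses X = {(Q, C). compactin X Q \<and> saturated_in X Q \<and> closedin X C \<and>
     Q \<inter> C \<noteq> {} \<and>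
     Q \<subseteq> up_closure X (Q \<inter> C) \<and>
     (\<forall>U. openin X U \<and> Q \<subseteq> U \<longrightarrow> C \<subseteq> X closure_of (U \<inter> C))}"

definition quasi_lens_space :: "'a topology \<Rightarrow> ('a set \<times> 'a set) topology" where
  "quasi_lens_space X = topology_generated_by
     ({{(Q, C) \<in> quasi_lenses X. Q \<subseteq> U} | U. openin X U} \<union>
      {{(Q, C) \<in> quasi_lenses X. C \<inter> U \<noteq> {}} | U. openin X U})"

definition lens_to_quasi_lens :: "'a topology \<Rightarrow> 'a set \<Rightarrow> 'a set \<times> 'a set" where
  "lens_to_quasi_lens X L = (up_closure X L, X closure_of L)"


section \<open>Well-definedness\<close>

lemma up_closure_subset_topspace: "up_closure X A \<subseteq> topspace X"
  by (auto simp: up_closure_def spec_le_def)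

lemma subset_up_closure: "A \<subseteq> topspace X \<Longrightarrow> A \<subseteq> up_closure X A"
  by (auto simp: up_closure_def spec_le_def)

lemma saturated_in_up_closure: "saturated_in X (up_closure X A)"
  unfolding saturated_in_def up_closure_def spec_le_def by blast

lemma up_closure_subset_open_iff:
  assumes "A \<subseteq> topspace X" "openin X U"
  shows "up_closure X A \<subseteq> U \<longleftrightarrow> A \<subseteq> U"
  using assms unfolding up_closure_def spec_le_def by blast

lemma compactin_up_closure:
  assumes "compactin X A"
  shows "compactin X (up_closure X A)"
  unfolding compactin_def
proof (intro conjI allI impI)
  show "up_closure X A \<subseteq> topspace X"
    by (rule up_closure_subset_topspace)
next
  fix \<U> assume U: "Ball \<U> (openin X) \<and> up_closure X A \<subseteq> \<Union>\<U>"
  have A: "A \<subseteq> topspace X"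
    using assms by (rule compactin_subset_topspace)
  then have "A \<subseteq> \<Union>\<U>"
    using U subset_up_closure by blast
  then obtain \<F> where F: "finite \<F>" "\<F> \<subseteq> \<U>" "A \<subseteq> \<Union>\<F>"
    using assms U by (auto simp: compactin_def)
  have "openin X (\<Union>\<F>)"
    using F U by (intro openin_Union) auto
  then have "up_closure X A \<subseteq> \<Union>\<F>"
    using F A up_closure_subset_open_iff by metis
  then show "\<exists>\<F>. finite \<F> \<and> \<F> \<subseteq> \<U> \<and> up_closure X A \<subseteq> \<Union>\<F>"
    using F by blast
qed

lemma lens_subset_topspace: "L \<in> lenses X \<Longrightarrow> L \<subseteq> topspace X"
  unfolding lenses_def using closedin_subset by blast

lemma lens_nonempty: "L \<in> lenses X \<Longrightarrow> L \<noteq> {}"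
  unfolding lenses_def by blast

lemma lens_compactin: "L \<in> lenses X \<Longrightarrow> compactin X L"
  unfolding lenses_def using compact_Int_closedin by fastforce

lemma lens_of_compactin:
  assumes "compactin X K" "K \<noteq> {}"
  shows "up_closure X K \<inter> X closure_of K \<in> lenses X"
proof -
  have "K \<subseteq> up_closure X K \<inter> X closure_of K"
    using assms by (simp add: closure_of_subset compactin_subset_topspace subset_up_closure)
  then have "up_closure X K \<inter> X closure_of K \<noteq> {}"
    using assms by blast
  then show ?thesis
    unfolding lenses_def mem_Collect_eq
    using compactin_up_closure[OF assms(1)] saturated_in_up_closure[of X K]
      closedin_closure_of[of X K]
    by (intro exI conjI) (rule refl, assumption+)
qed

lemma lens_eq:
  assumes "L \<in> lenses X"
  shows "up_closure X L \<inter> X closure_of L = L"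
proof -
  obtain Q C where *: "L = Q \<inter> C" "saturated_in X Q" "closedin X C"
    using assms unfolding lenses_def by blast
  have "up_closure X L \<subseteq> Q"
    using * unfolding up_closure_def saturated_in_def by blast
  moreover have "X closure_of L \<subseteq> C"
    using * by (simp add: closure_of_minimal)
  moreover have "L \<subseteq> up_closure X L \<inter> X closure_of L"
    using assms by (simp add: closure_of_subset lens_subset_topspace subset_up_closure)
  ultimately show ?thesis
    using * by blast
qed

lemma topspace_hoare_space: "topspace (hoare_space X) = {C. closedin X C \<and> C \<noteq> {}}"
proof -
  have "C \<inter> topspace X = C" if "closedin X C" for C
    using that closedin_subset by blast
  then show ?thesis
    unfolding hoare_space_def topology_generated_by_topspace by blast
qed

lemma topspace_lens_space: "topspace (lens_space X) = lenses X"
proof -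
  have "lenses X = {L \<in> lenses X. L \<subseteq> topspace X}"
    using lens_subset_topspace by auto
  then show ?thesis
    unfolding lens_space_def topology_generated_by_topspace by blast
qed

lemma topspace_quasi_lens_space: "topspace (quasi_lens_space X) = quasi_lenses X"
proof -
  have "Q \<subseteq> topspace X" if "(Q, C) \<in> quasi_lenses X" for Q C
    using that compactin_subset_topspace by (auto simp: quasi_lenses_def)
  then have "quasi_lenses X = {(Q, C) \<in> quasi_lenses X. Q \<subseteq> topspace X}"
    by auto
  then show ?thesis
    unfolding quasi_lens_space_def topology_generated_by_topspace by blast
qed

lemma lens_to_quasi_lens_in:
  assumes L: "L \<in> lenses X"
  shows "lens_to_quasi_lens X L \<in> quasi_lenses X"
proof -
  have "X closure_of L \<subseteq> X closure_of (U \<inter> X closure_of L)"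
    if "openin X U" "up_closure X L \<subseteq> U" for U
  proof (rule closure_of_mono)
    show "L \<subseteq> U \<inter> X closure_of L"
      using that subset_up_closure[OF lens_subset_topspace[OF L]]
        closure_of_subset[OF lens_subset_topspace[OF L]] by blast
  qed
  then show ?thesis
    using L unfolding quasi_lenses_def lens_to_quasi_lens_def
    by (simp add: lens_eq compactin_up_closure lens_compactin saturated_in_up_closure lens_nonempty)
qed

lemma continuous_map_spec_le:
  assumes "continuous_map X Y f" "spec_le X x y"
  shows "spec_le Y (f x) (f y)"
  unfolding spec_le_def
proof (intro conjI allI impI)
  show "f x \<in> topspace Y" "f y \<in> topspace Y"
    using assms unfolding spec_le_def continuous_map_def by blast+
  fix U assume "openin Y U \<and> f x \<in> U"
  then have "openin X {z \<in> topspace X. f z \<in> U}"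
    using assms(1) openin_continuous_map_preimage by blast
  then show "f y \<in> U"
    using assms(2) \<open>openin Y U \<and> f x \<in> U\<close> unfolding spec_le_def by blast
qed

lemma lens_map_in:
  assumes f: "continuous_map X Y f" and L: "L \<in> lenses X"
  shows "lens_map Y f L \<in> lenses Y"
  unfolding lens_map_def
  using image_compactin[OF lens_compactin[OF L] f] lens_nonempty[OF L]
  by (intro lens_of_compactin) auto

lemma lens_map_subset_iff:
  assumes f: "f ` L \<subseteq> topspace Y" and U: "openin Y U"
  shows "lens_map Y f L \<subseteq> U \<longleftrightarrow> f ` L \<subseteq> U"
  using subset_up_closure[OF f] closure_of_subset[OF f] up_closure_subset_open_iff[OF f U]
  unfolding lens_map_def by blast

lemma lens_map_meets_iff:
  assumes f: "f ` L \<subseteq> topspace Y" and U: "openin Y U"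
  shows "lens_map Y f L \<inter> U \<noteq> {} \<longleftrightarrow> f ` L \<inter> U \<noteq> {}"
proof -
  have "Y closure_of (f ` L) \<inter> U \<noteq> {} \<longleftrightarrow> f ` L \<inter> U \<noteq> {}"
    using openin_Int_closure_of_eq_empty[OF U, of "f ` L"] by (simp add: Int_commute)
  then show ?thesis
    using subset_up_closure[OF f] closure_of_subset[OF f] unfolding lens_map_def by blast
qed

lemma continuous_map_lens_map:
  assumes f: "continuous_map X Y f"
  shows "continuous_map (lens_space X) (lens_space Y) (lens_map Y f)"
proof -
  have im: "f ` L \<subseteq> topspace Y" if "L \<in> lenses X" for L
    using f lens_subset_topspace[OF that] continuous_map_image_subset_topspace by fastforce
  have box: "openin (lens_space X) {L \<in> lenses X. L \<subseteq> U}" if "openin X U" for U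
    using that unfolding lens_space_def by (intro topology_generated_by_Basis) blast
  have dia: "openin (lens_space X) {L \<in> lenses X. L \<inter> U \<noteq> {}}" if "openin X U" for U
    using that unfolding lens_space_def by (intro topology_generated_by_Basis) blast
  have pre: "openin (lens_space X) (lens_map Y f -` {L \<in> lenses Y. L \<subseteq> U} \<inter> lenses X)"
    "openin (lens_space X) (lens_map Y f -` {L \<in> lenses Y. L \<inter> U \<noteq> {}} \<inter> lenses X)"
    if U: "openin Y U" for U
  proof -
    define V where "V = {x \<in> topspace X. f x \<in> U}"
    have V: "openin X V"
      unfolding V_def using f U by (rule openin_continuous_map_preimage)
    have "f ` L \<subseteq> U \<longleftrightarrow> L \<subseteq> V" if "L \<in> lenses X" for L
      using lens_subset_topspace[OF that] unfolding V_def by blast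
    then have "lens_map Y f -` {L \<in> lenses Y. L \<subseteq> U} \<inter> lenses X = {L \<in> lenses X. L \<subseteq> V}"
      using lens_map_in[OF f] lens_map_subset_iff[OF im U]
      unfolding set_eq_iff Int_iff vimage_eq mem_Collect_eq by metis
    then show "openin (lens_space X) (lens_map Y f -` {L \<in> lenses Y. L \<subseteq> U} \<inter> lenses X)"
      using box[OF V] by simp
    have "f ` L \<inter> U \<noteq> {} \<longleftrightarrow> L \<inter> V \<noteq> {}" if "L \<in> lenses X" for L
      using lens_subset_topspace[OF that] unfolding V_def by blast
    then have "lens_map Y f -` {L \<in> lenses Y. L \<inter> U \<noteq> {}} \<inter> lenses X = {L \<in> lenses X. L \<inter> V \<noteq> {}}"
      using lens_map_in[OF f] lens_map_meets_iff[OF im U]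
      unfolding set_eq_iff[of "_ -` _ \<inter> _"] Int_iff[of _ "_ -` _"] vimage_eq mem_Collect_eq by metis
    then show "openin (lens_space X) (lens_map Y f -` {L \<in> lenses Y. L \<inter> U \<noteq> {}} \<inter> lenses X)"
      using dia[OF V] by simp
  qed
  have "continuous_map (lens_space X) (topology_generated_by
     ({{L \<in> lenses Y. L \<subseteq> U} | U. openin Y U} \<union> {{L \<in> lenses Y. L \<inter> U \<noteq> {}} | U. openin Y U}))
     (lens_map Y f)"
  proof (rule continuous_on_generated_topo)
    fix S assume "S \<in> {{L \<in> lenses Y. L \<subseteq> U} | U. openin Y U} \<union>
      {{L \<in> lenses Y. L \<inter> U \<noteq> {}} | U. openin Y U}"
    then show "openin (lens_space X) (lens_map Y f -` S \<inter> topspace (lens_space X))"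
      using pre by (auto simp: topspace_lens_space)
  next
    have "\<Union> ({{L \<in> lenses Y. L \<subseteq> U} | U. openin Y U} \<union>
        {{L \<in> lenses Y. L \<inter> U \<noteq> {}} | U. openin Y U}) = lenses Y"
      using topspace_lens_space[of Y] unfolding lens_space_def by simp
    then show "lens_map Y f ` topspace (lens_space X) \<subseteq> \<Union> ({{L \<in> lenses Y. L \<subseteq> U} | U. openin Y U} \<union>
        {{L \<in> lenses Y. L \<inter> U \<noteq> {}} | U. openin Y U})"
      using lens_map_in[OF f] by (auto simp: topspace_lens_space)
  qed
  then show ?thesis
    by (simp only: lens_space_def[of Y])
qed

lemma closure_of_image_closure_of:
  assumes g: "continuous_map Y Z g" and A: "A \<subseteq> topspace Y"
  shows "Z closure_of (g ` (Y closure_of A)) = Z closure_of (g ` A)"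
proof
  have "g ` (Y closure_of A) \<subseteq> Z closure_of (g ` A)"
    using g A by (simp add: continuous_map_image_closure_subset)
  then show "Z closure_of (g ` (Y closure_of A)) \<subseteq> Z closure_of (g ` A)"
    by (simp add: closure_of_minimal)
  show "Z closure_of (g ` A) \<subseteq> Z closure_of (g ` (Y closure_of A))"
    by (simp add: A closure_of_mono closure_of_subset image_mono)
qed

lemma lens_map_comp:
  assumes f: "continuous_map X Y f" and g: "continuous_map Y Z g" and L: "L \<in> lenses X"
  shows "lens_map Z g (lens_map Y f L) = lens_map Z (g \<circ> f) L"
proof -
  have im: "f ` L \<subseteq> topspace Y"
    using f lens_subset_topspace[OF L] continuous_map_image_subset_topspace by fastforce
  have sub: "f ` L \<subseteq> lens_map Y f L"
    using subset_up_closure[OF im] closure_of_subset[OF im] unfolding lens_map_def by blast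
  have "up_closure Z (g ` lens_map Y f L) \<subseteq> up_closure Z (g ` f ` L)"
  proof
    fix z assume "z \<in> up_closure Z (g ` lens_map Y f L)"
    then obtain y x where "spec_le Y (f x) y" "x \<in> L" "spec_le Z (g y) z"
      unfolding up_closure_def lens_map_def by blast
    moreover from this have "spec_le Z (g (f x)) (g y)"
      using continuous_map_spec_le[OF g] by blast
    ultimately have "spec_le Z (g (f x)) z" "x \<in> L"
      unfolding spec_le_def by blast+
    then show "z \<in> up_closure Z (g ` f ` L)"
      unfolding up_closure_def by blast
  qed
  moreover have "up_closure Z (g ` f ` L) \<subseteq> up_closure Z (g ` lens_map Y f L)"
    using sub unfolding up_closure_def by blast
  moreover have "Z closure_of (g ` lens_map Y f L) \<subseteq> Z closure_of (g ` (Y closure_of (f ` L)))"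
    unfolding lens_map_def by (intro closure_of_mono) blast
  moreover have "Z closure_of (g ` f ` L) \<subseteq> Z closure_of (g ` lens_map Y f L)"
    using sub by (intro closure_of_mono) blast
  ultimately show ?thesis
    using closure_of_image_closure_of[OF g im] unfolding lens_map_def[of Z] image_comp[symmetric]
    by blast
qed

lemma hoare_map_in:
  assumes "continuous_map X Y f" "closedin X C" "C \<noteq> {}"
  shows "closedin Y (hoare_map Y f C) \<and> hoare_map Y f C \<noteq> {}"
proof -
  have "f ` C \<subseteq> topspace Y"
    using assms closedin_subset continuous_map_image_subset_topspace by fastforce
  then show ?thesis
    using assms closure_of_subset[of "f ` C" Y] unfolding hoare_map_def by auto
qed

lemma continuous_map_hoare_map:
  assumes f: "continuous_map X Y f"
  shows "continuous_map (hoare_space X) (hoare_space Y) (hoare_map Y f)"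
proof -
  have "continuous_map (hoare_space X)
     (topology_generated_by {{C. closedin Y C \<and> C \<noteq> {} \<and> C \<inter> U \<noteq> {}} | U. openin Y U})
     (hoare_map Y f)"
  proof (rule continuous_on_generated_topo)
    fix S assume "S \<in> {{C. closedin Y C \<and> C \<noteq> {} \<and> C \<inter> U \<noteq> {}} | U. openin Y U}"
    then obtain U where U: "openin Y U" and S: "S = {C. closedin Y C \<and> C \<noteq> {} \<and> C \<inter> U \<noteq> {}}"
      by blast
    let ?V = "{x \<in> topspace X. f x \<in> U}"
    have "openin X ?V"
      using f U by (rule openin_continuous_map_preimage)
    then have V: "openin (hoare_space X) {C. closedin X C \<and> C \<noteq> {} \<and> C \<inter> ?V \<noteq> {}}"
      unfolding hoare_space_def by (intro topology_generated_by_Basis) blast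
    have "hoare_map Y f C \<inter> U \<noteq> {} \<longleftrightarrow> C \<inter> ?V \<noteq> {}" if "closedin X C" for C
    proof -
      have "hoare_map Y f C \<inter> U \<noteq> {} \<longleftrightarrow> f ` C \<inter> U \<noteq> {}"
        using openin_Int_closure_of_eq_empty[OF U, of "f ` C"]
        by (simp add: Int_commute hoare_map_def)
      then show ?thesis
        using closedin_subset[OF that] by blast
    qed
    then have "hoare_map Y f -` S \<inter> topspace (hoare_space X) =
        {C. closedin X C \<and> C \<noteq> {} \<and> C \<inter> ?V \<noteq> {}}"
      using hoare_map_in[OF f] unfolding S topspace_hoare_space by auto
    then show "openin (hoare_space X) (hoare_map Y f -` S \<inter> topspace (hoare_space X))"
      using V by simp
  next
    have "\<Union> {{C. closedin Y C \<and> C \<noteq> {} \<and> C \<inter> U \<noteq> {}} | U. openin Y U} =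
        {C. closedin Y C \<and> C \<noteq> {}}"
      using topspace_hoare_space[of Y] unfolding hoare_space_def by simp
    then show "hoare_map Y f ` topspace (hoare_space X) \<subseteq>
        \<Union> {{C. closedin Y C \<and> C \<noteq> {} \<and> C \<inter> U \<noteq> {}} | U. openin Y U}"
      using hoare_map_in[OF f] by (auto simp: topspace_hoare_space)
  qed
  then show ?thesis
    by (simp only: hoare_space_def[of Y])
qed

proposition projective_system_hoare_space:
  assumes "projective_system I le X p"
  shows "projective_system I le (\<lambda>i. hoare_space (X i)) (\<lambda>i j. hoare_map (X i) (p i j))"
proof -
  have cont: "continuous_map (X j) (X i) (p i j)" if "i \<in> I" "j \<in> I" "le i j" for i j
    using assms that unfolding projective_system_def by blast
  have pid: "p i i x = x" if "i \<in> I" "x \<in> topspace (X i)" for i x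
    using assms that unfolding projective_system_def by blast
  have pcomp: "p i j (p j k x) = p i k x"
    if "i \<in> I" "j \<in> I" "k \<in> I" "le i j" "le j k" "x \<in> topspace (X k)" for i j k x
    using assms that unfolding projective_system_def by blast
  have ident: "hoare_map (X i) (p i i) C = C" if "i \<in> I" "closedin (X i) C" for i C
  proof -
    have "p i i ` C = C"
      using closedin_subset[OF that(2)] pid[OF that(1)] by force
    then show ?thesis
      using that unfolding hoare_map_def by (simp add: closure_of_closedin)
  qed
  have comp: "hoare_map (X i) (p i j) (hoare_map (X j) (p j k) C) = hoare_map (X i) (p i k) C"
    if ijk: "i \<in> I" "j \<in> I" "k \<in> I" "le i j" "le j k" and C: "closedin (X k) C" for i j k C
  proof -
    have "p j k ` C \<subseteq> topspace (X j)"
      using continuous_map_image_subset_topspace[OF cont[OF ijk(2,3,5)]] closedin_subset[OF C]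
      by blast
    moreover have "p i j ` p j k ` C = p i k ` C"
      unfolding image_image using pcomp[OF ijk] closedin_subset[OF C]
      by (intro image_cong refl) blast
    ultimately show ?thesis
      using closure_of_image_closure_of[OF cont[OF ijk(1,2,4)]] unfolding hoare_map_def by metis
  qed
  show ?thesis
    unfolding projective_system_def topspace_hoare_space
  proof (intro conjI ballI allI impI)
    show "reflp_on I le" "transp_on I le" "I \<noteq> {}"
      using assms unfolding projective_system_def by blast+
    show "\<exists>k\<in>I. le i k \<and> le j k" if "i \<in> I" "j \<in> I" for i j
      using assms that unfolding projective_system_def by blast
  qed (auto simp: cont ident comp intro!: continuous_map_hoare_map)
qed

proposition projective_system_lens_space:
  assumes "projective_system I le X p"
  shows "projective_system I le (\<lambda>i. lens_space (X i)) (\<lambda>i j. lens_map (X i) (p i j))"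
proof -
  have cont: "continuous_map (X j) (X i) (p i j)" if "i \<in> I" "j \<in> I" "le i j" for i j
    using assms that unfolding projective_system_def by blast
  have pid: "p i i x = x" if "i \<in> I" "x \<in> topspace (X i)" for i x
    using assms that unfolding projective_system_def by blast
  have pcomp: "p i j (p j k x) = p i k x"
    if "i \<in> I" "j \<in> I" "k \<in> I" "le i j" "le j k" "x \<in> topspace (X k)" for i j k x
    using assms that unfolding projective_system_def by blast
  have ident: "lens_map (X i) (p i i) L = L" if "i \<in> I" "L \<in> lenses (X i)" for i L
  proof -
    have "p i i ` L = L"
      using lens_subset_topspace[OF that(2)] pid[OF that(1)] by force
    then show ?thesis
      using that unfolding lens_map_def by (simp add: lens_eq)
  qed
  have comp: "lens_map (X i) (p i j) (lens_map (X j) (p j k) L) = lens_map (X i) (p i k) L"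
    if ijk: "i \<in> I" "j \<in> I" "k \<in> I" "le i j" "le j k" and L: "L \<in> lenses (X k)" for i j k L
  proof -
    have "(p i j \<circ> p j k) ` L = p i k ` L"
      unfolding comp_def using pcomp[OF ijk] lens_subset_topspace[OF L]
      by (intro image_cong refl) blast
    then show ?thesis
      using lens_map_comp[OF cont[OF ijk(2,3,5)] cont[OF ijk(1,2,4)] L]
      unfolding lens_map_def by metis
  qed
  show ?thesis
    unfolding projective_system_def topspace_lens_space
  proof (intro conjI ballI allI impI)
    show "reflp_on I le" "transp_on I le" "I \<noteq> {}"
      using assms unfolding projective_system_def by blast+
    show "\<exists>k\<in>I. le i k \<and> le j k" if "i \<in> I" "j \<in> I" for i j
      using assms that unfolding projective_system_def by blast
  qed (auto simp: cont ident comp intro!: continuous_map_lens_map)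
qed

end

theory Submission
  imports Defs
begin

text \<open>
  The map \<open>L \<mapsto> (lens_map p\<^sub>i L)\<^sub>i\<close> is compared with the limit of the spaces of lenses in two
  independent ways.

  \<^bold>\<open>Embedding.\<close>  Every open set \<open>U\<close> of the limit is a directed union of cylinders: \<open>U\<close> is covered
  by the inverse images of the open sets \<open>shadow U i\<close>, where \<open>shadow U i\<close> is the largest open set
  of \<open>X\<^sub>i\<close> whose inverse image lies in \<open>U\<close>.  As a lens is compact, it lies in \<open>U\<close> iff at some stage
  \<open>i\<close> its image lies in \<open>shadow U i\<close>; and it meets \<open>U\<close> iff at some stage its image meets
  \<open>shadow U i\<close>.  Thus the topology on lenses of the limit is the initial one for the maps
  \<open>lens_map p\<^sub>i\<close>, and since a lens is determined by the open sets containing it and those meeting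
  it, these maps separate lenses.

  \<^bold>\<open>Surjectivity.\<close>  Let \<open>L\<^sub>i\<close> be a compatible family of lenses.  Their closures form a compatible
  family of closed sets, which by the hypothesis on Hoare hyperspaces comes from a closed set \<open>C\<close> of
  the limit.  Their upward closures \<open>Q\<^sub>i\<close> form a compatible family of compact saturated sets; let \<open>Q\<close>
  be the set of all points of the limit with coordinates in the \<open>Q\<^sub>i\<close>.  The pair \<open>(Q, C)\<close> turns out
  to be a quasi-lens, so by the hypothesis on \<open>\<iota>\<close> it is \<open>(\<up>L, cl L)\<close> for some lens \<open>L\<close> of the limit.
  As \<open>\<up>p\<^sub>i[Q] = Q\<^sub>i\<close> and \<open>cl p\<^sub>i[C] = cl L\<^sub>i\<close>, and a lens is the intersection of its upward closure and
  its closure, the image of \<open>L\<close> is the given family.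

  Everything about \<open>Q\<close> rests on \<open>exists_thread\<close>, a form of Steenrod's theorem for sober spaces: if
  closed sets \<open>C\<^sub>i\<close>, mapped into each other by the bonding maps, all meet the compact saturated sets
  \<open>Q\<^sub>i\<close>, then some point of the limit has all its coordinates in \<open>Q\<^sub>i \<inter> C\<^sub>i\<close>.  By Zorn's lemma and
  compactness one may take the family \<open>C\<^sub>i\<close> minimal.  Then each \<open>C\<^sub>i\<close> is irreducible, hence by
  sobriety the closure of a unique point, and these generic points form the required point.
\<close>

section \<open>Spaces, closures and lenses\<close>

lemma spec_le_iff_closure_of:
  "spec_le X x y \<longleftrightarrow> y \<in> topspace X \<and> x \<in> X closure_of {y}"
  unfolding spec_le_def in_closure_of by blast

lemma t0_space_closure_of_eq:
  assumes t0: "t0_space X" and x: "x \<in> X closure_of {y}" and y: "y \<in> X closure_of {x}"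
  shows "x = y"
proof (rule ccontr)
  assume ne: "x \<noteq> y"
  have "x \<in> topspace X" "y \<in> topspace X"
    using x y by (simp_all add: in_closure_of)
  then obtain U where "openin X U" "x \<notin> U \<longleftrightarrow> y \<in> U"
    using t0 ne unfolding t0_space_def by metis
  then show False
    using x y by (auto simp: in_closure_of)
qed

lemma spec_le_trans: "spec_le X x y \<Longrightarrow> spec_le X y z \<Longrightarrow> spec_le X x z"
  unfolding spec_le_def by blast

lemma up_closure_saturated:
  assumes "saturated_in X Q"
  shows "up_closure X Q = Q"
  using assms unfolding up_closure_def saturated_in_def spec_le_def by blast

text \<open>
  The complement of \<open>X closure_of {y}\<close> is the largest open set that misses \<open>y\<close>, so the upward
  closure of a set is the intersection of its open neighbourhoods.
\<close>

lemma up_closure_subsetI: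
  assumes K: "K \<subseteq> topspace X" and Q: "Q \<subseteq> topspace X"
    and sub: "\<And>U. openin X U \<Longrightarrow> K \<subseteq> U \<Longrightarrow> Q \<subseteq> U"
  shows "Q \<subseteq> up_closure X K"
proof
  fix y assume y: "y \<in> Q"
  have "openin X (topspace X - X closure_of {y})"
    by (simp add: openin_diff)
  then have "\<not> K \<subseteq> topspace X - X closure_of {y}"
    using sub[of "topspace X - X closure_of {y}"] y Q closure_of_subset[of "{y}" X] by blast
  then obtain x where "x \<in> K" "x \<in> X closure_of {y}"
    using K by blast
  then show "y \<in> up_closure X K"
    using y Q unfolding up_closure_def spec_le_iff_closure_of by blast
qed

lemma up_closure_image_up_closure:
  assumes f: "continuous_map X Y f" and A: "A \<subseteq> topspace X"
  shows "up_closure Y (f ` up_closure X A) = up_closure Y (f ` A)"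
proof
  show "up_closure Y (f ` up_closure X A) \<subseteq> up_closure Y (f ` A)"
    unfolding up_closure_def using continuous_map_spec_le[OF f] spec_le_trans by fast
  show "up_closure Y (f ` A) \<subseteq> up_closure Y (f ` up_closure X A)"
    using subset_up_closure[OF A] unfolding up_closure_def by blast
qed

lemma closure_of_lens_map:
  assumes f: "f ` L \<subseteq> topspace Y"
  shows "Y closure_of lens_map Y f L = Y closure_of (f ` L)"
proof
  show "Y closure_of lens_map Y f L \<subseteq> Y closure_of (f ` L)"
    unfolding lens_map_def by (simp add: closure_of_minimal)
  have "f ` L \<subseteq> lens_map Y f L"
    using subset_up_closure[OF f] closure_of_subset[OF f] unfolding lens_map_def by blast
  then show "Y closure_of (f ` L) \<subseteq> Y closure_of lens_map Y f L"
    by (rule closure_of_mono)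
qed

lemma up_closure_lens_map:
  assumes f: "f ` L \<subseteq> topspace Y"
  shows "up_closure Y (lens_map Y f L) = up_closure Y (f ` L)"
proof
  show "up_closure Y (lens_map Y f L) \<subseteq> up_closure Y (f ` L)"
    unfolding lens_map_def up_closure_def using spec_le_trans by fast
  have "f ` L \<subseteq> lens_map Y f L"
    using subset_up_closure[OF f] closure_of_subset[OF f] unfolding lens_map_def by blast
  then show "up_closure Y (f ` L) \<subseteq> up_closure Y (lens_map Y f L)"
    unfolding up_closure_def by blast
qed

lemma openin_lens_box: "openin X U \<Longrightarrow> openin (lens_space X) {L \<in> lenses X. L \<subseteq> U}"
  unfolding lens_space_def by (intro topology_generated_by_Basis) blast

lemma openin_lens_meets: "openin X U \<Longrightarrow> openin (lens_space X) {L \<in> lenses X. L \<inter> U \<noteq> {}}"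
  unfolding lens_space_def by (intro topology_generated_by_Basis) blast

text \<open>
  The open sets containing \<open>L\<close> determine its upward closure, those meeting \<open>L\<close> determine its
  closure, and a lens is the intersection of the two.  Applied in both directions this is the
  \<open>T\<^sub>0\<close> property of the space of lenses.
\<close>

lemma lens_subsetI:
  assumes L: "L \<in> lenses X" and M: "M \<in> lenses X"
    and box: "\<And>U. openin X U \<Longrightarrow> L \<subseteq> U \<Longrightarrow> M \<subseteq> U"
    and dia: "\<And>U. openin X U \<Longrightarrow> M \<inter> U \<noteq> {} \<Longrightarrow> L \<inter> U \<noteq> {}"
  shows "M \<subseteq> L"
proof -
  have "M \<subseteq> up_closure X L"
    using L M box by (intro up_closure_subsetI lens_subset_topspace)
  moreover have "M \<subseteq> X closure_of L"
    using dia lens_subset_topspace[OF M] unfolding in_closure_of subset_iff by blast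
  ultimately show ?thesis
    using lens_eq[OF L] by blast
qed

lemma homeomorphic_map_generated:
  assumes Y: "Y = topology_generated_by S"
    and cont: "continuous_map Y Z f" and bij: "bij_betw f (topspace Y) (topspace Z)"
    and op: "\<And>s. s \<in> S \<Longrightarrow> openin Z (f ` s)"
  shows "homeomorphic_map Y Z f"
proof -
  define g where "g = inv_into (topspace Y) f"
  have g: "g y \<in> topspace Y" "f (g y) = y" if "y \<in> topspace Z" for y
    using that bij unfolding g_def bij_betw_def by (auto simp: inv_into_into f_inv_into_f)
  have gf: "g (f x) = x" if "x \<in> topspace Y" for x
    using that bij unfolding g_def bij_betw_def by simp
  have top: "topspace Y = \<Union>S"
    unfolding Y topology_generated_by_topspace ..
  have "continuous_map Z (topology_generated_by S) g"
  proof (rule continuous_on_generated_topo)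
    fix s assume s: "s \<in> S"
    then have sub: "s \<subseteq> topspace Y"
      unfolding top by blast
    have "g -` s \<inter> topspace Z = f ` s"
    proof
      show "g -` s \<inter> topspace Z \<subseteq> f ` s"
        using g by (auto simp: image_iff) metis
      show "f ` s \<subseteq> g -` s \<inter> topspace Z"
        using gf sub bij unfolding bij_betw_def by auto
    qed
    then show "openin Z (g -` s \<inter> topspace Z)"
      using op[OF s] by simp
  next
    show "g ` topspace Z \<subseteq> \<Union>S"
      using g top by auto
  qed
  then have "homeomorphic_maps Y Z f g"
    unfolding homeomorphic_maps_def using cont g gf Y by auto
  then show ?thesis
    unfolding homeomorphic_map_maps by blast
qed


section \<open>Projective systems and the open sets of the limit\<close>

locale projective_sys =
  fixes I :: "'i set"
    and le :: "'i \<Rightarrow> 'i \<Rightarrow> bool"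
    and X :: "'i \<Rightarrow> 'a topology"
    and p :: "'i \<Rightarrow> 'i \<Rightarrow> 'a \<Rightarrow> 'a"
  assumes system: "projective_system I le X p"
begin

abbreviation Xlim :: "('i \<Rightarrow> 'a) topology" where
  "Xlim \<equiv> projective_limit I le X p"

lemma le_refl: "i \<in> I \<Longrightarrow> le i i"
  using system unfolding projective_system_def by (blast dest: reflp_onD)

lemma le_trans: "i \<in> I \<Longrightarrow> j \<in> I \<Longrightarrow> k \<in> I \<Longrightarrow> le i j \<Longrightarrow> le j k \<Longrightarrow> le i k"
  using system unfolding projective_system_def by (blast dest: transp_onD)

lemma directed:
  assumes "i \<in> I" "j \<in> I"
  obtains k where "k \<in> I" "le i k" "le j k"
  using system assms unfolding projective_system_def by blast

lemma index_nonempty: "I \<noteq> {}"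
  using system unfolding projective_system_def by blast

lemma cont: "i \<in> I \<Longrightarrow> j \<in> I \<Longrightarrow> le i j \<Longrightarrow> continuous_map (X j) (X i) (p i j)"
  using system unfolding projective_system_def by blast

lemma p_in: "i \<in> I \<Longrightarrow> j \<in> I \<Longrightarrow> le i j \<Longrightarrow> x \<in> topspace (X j) \<Longrightarrow> p i j x \<in> topspace (X i)"
  using cont[of i j] by (auto simp: continuous_map_def)

lemma p_id: "i \<in> I \<Longrightarrow> x \<in> topspace (X i) \<Longrightarrow> p i i x = x"
  using system unfolding projective_system_def by blast

lemma p_comp:
  "i \<in> I \<Longrightarrow> j \<in> I \<Longrightarrow> k \<in> I \<Longrightarrow> le i j \<Longrightarrow> le j k \<Longrightarrow> x \<in> topspace (X k)
    \<Longrightarrow> p i j (p j k x) = p i k x"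
  using system unfolding projective_system_def by blast

lemma in_limit_iff:
  "x \<in> topspace Xlim \<longleftrightarrow>
    x \<in> extensional I \<and> (\<forall>i\<in>I. x i \<in> topspace (X i)) \<and>
    (\<forall>i\<in>I. \<forall>j\<in>I. le i j \<longrightarrow> p i j (x j) = x i)"
  unfolding projective_limit_def by (auto simp: PiE_iff)

lemma limit_in: "x \<in> topspace Xlim \<Longrightarrow> i \<in> I \<Longrightarrow> x i \<in> topspace (X i)"
  by (simp add: in_limit_iff)

lemma limit_compat: "x \<in> topspace Xlim \<Longrightarrow> i \<in> I \<Longrightarrow> j \<in> I \<Longrightarrow> le i j \<Longrightarrow> p i j (x j) = x i"
  by (simp add: in_limit_iff)

lemma proj_cont: "i \<in> I \<Longrightarrow> continuous_map Xlim (X i) (\<lambda>x. x i)"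
  unfolding projective_limit_def
  by (intro continuous_map_from_subtopology continuous_map_product_projection)

lemma openin_cylinder:
  "i \<in> I \<Longrightarrow> openin (X i) V \<Longrightarrow> openin Xlim {x \<in> topspace Xlim. x i \<in> V}"
  using proj_cont by (rule openin_continuous_map_preimage)

lemma finite_upper_bound:
  assumes "finite F" "F \<subseteq> I"
  shows "\<exists>k\<in>I. \<forall>i\<in>F. le i k"
  using assms
proof (induction F)
  case empty
  then show ?case using index_nonempty by blast
next
  case (insert a F)
  then obtain k where k: "k \<in> I" "\<forall>i\<in>F. le i k" by blast
  obtain l where l: "l \<in> I" "le a l" "le k l"
    using directed[of a k] insert k by blast
  then have "\<forall>i\<in>insert a F. le i l"
    using k insert.prems le_trans by blast
  then show ?case using l by blast
qed

text \<open>
  A basic open set of the product constrains finitely many coordinates.  In the limit all of them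
  are functions of the coordinate at a common upper bound, so one coordinate suffices.
\<close>

lemma limit_basis:
  assumes U: "openin Xlim U" and x: "x \<in> U"
  obtains i V where "i \<in> I" "openin (X i) V" "x i \<in> V" "{y \<in> topspace Xlim. y i \<in> V} \<subseteq> U"
proof -
  let ?S = "{x. \<forall>i\<in>I. \<forall>j\<in>I. le i j \<longrightarrow> p i j (x j) = x i}"
  obtain T where T: "openin (product_topology X I) T" and UT: "U = T \<inter> ?S"
    using U unfolding projective_limit_def openin_subtopology by blast
  have xL: "x \<in> topspace Xlim"
    using openin_subset[OF U] x by blast
  obtain W where W: "finite {i \<in> I. W i \<noteq> topspace (X i)}" "\<And>i. i \<in> I \<Longrightarrow> openin (X i) (W i)"
      "x \<in> Pi\<^sub>E I W" "Pi\<^sub>E I W \<subseteq> T"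
    using T[unfolded openin_product_topology_alt, rule_format, of x] x UT by auto
  define F where "F = {i \<in> I. W i \<noteq> topspace (X i)}"
  obtain k where k: "k \<in> I" "\<And>i. i \<in> F \<Longrightarrow> le i k"
    using finite_upper_bound[of F] W(1) unfolding F_def by blast
  define V where "V = (\<Inter>i\<in>F. {z \<in> topspace (X k). p i k z \<in> W i}) \<inter> topspace (X k)"
  have "openin (X k) V"
    unfolding V_def
  proof (rule openin_INT)
    show "finite F" using W(1) unfolding F_def .
    fix i assume i: "i \<in> F"
    then have "i \<in> I" unfolding F_def by blast
    then show "openin (X k) {z \<in> topspace (X k). p i k z \<in> W i}"
      using cont k i W(2) by (intro openin_continuous_map_preimage[of _ "X i"]) auto
  qed
  moreover have "x k \<in> V"
    using W(3) k xL limit_compat[OF xL] limit_in[OF xL] unfolding V_def F_def by (auto simp: PiE_iff)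
  moreover have "{y \<in> topspace Xlim. y k \<in> V} \<subseteq> U"
  proof
    fix y assume y: "y \<in> {y \<in> topspace Xlim. y k \<in> V}"
    have "y i \<in> W i" if i: "i \<in> I" for i
    proof (cases "i \<in> F")
      case True
      then have "p i k (y k) \<in> W i" using y unfolding V_def by blast
      then show ?thesis using limit_compat[of y i k] y i k True by simp
    next
      case False
      then show ?thesis using limit_in[of y i] y i unfolding F_def by simp
    qed
    then have "y \<in> Pi\<^sub>E I W"
      using y by (simp add: in_limit_iff PiE_iff)
    then show "y \<in> U"
      using W(4) y unfolding UT in_limit_iff by blast
  qed
  ultimately show ?thesis using that k(1) by blast
qed

text \<open>
  The largest open set of \<open>X i\<close> whose inverse image in the limit lies in \<open>U\<close>.  Choosing it
  uniformly in \<open>i\<close> makes the family monotone along the bonding maps (\<open>shadow_mono\<close>), which turns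
  the cover of an open set by cylinders into a directed one.
\<close>

definition shadow :: "('i \<Rightarrow> 'a) set \<Rightarrow> 'i \<Rightarrow> 'a set" where
  "shadow U i = \<Union>{V. openin (X i) V \<and> {x \<in> topspace Xlim. x i \<in> V} \<subseteq> U}"

lemma openin_shadow: "openin (X i) (shadow U i)"
  unfolding shadow_def by (intro openin_Union) blast

lemma shadow_subset: "x \<in> topspace Xlim \<Longrightarrow> x i \<in> shadow U i \<Longrightarrow> x \<in> U"
  unfolding shadow_def by blast

lemma in_shadow:
  assumes "openin Xlim U" "x \<in> U"
  obtains i where "i \<in> I" "x i \<in> shadow U i"
proof -
  from limit_basis[OF assms] obtain i V where "i \<in> I" "openin (X i) V" "x i \<in> V"
    "{y \<in> topspace Xlim. y i \<in> V} \<subseteq> U" by blast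
  then show ?thesis using that unfolding shadow_def by blast
qed

lemma shadow_mono:
  assumes ij: "i \<in> I" "j \<in> I" "le i j" and x: "x \<in> topspace (X j)" "p i j x \<in> shadow U i"
  shows "x \<in> shadow U j"
proof -
  obtain V where V: "openin (X i) V" "p i j x \<in> V" "{x \<in> topspace Xlim. x i \<in> V} \<subseteq> U"
    using x(2) unfolding shadow_def by blast
  let ?W = "{z \<in> topspace (X j). p i j z \<in> V}"
  have "openin (X j) ?W"
    using cont[OF ij] V(1) by (rule openin_continuous_map_preimage)
  moreover have "{y \<in> topspace Xlim. y j \<in> ?W} \<subseteq> U"
    using V(3) limit_compat ij by auto
  moreover have "x \<in> ?W" using x V by blast
  ultimately show ?thesis unfolding shadow_def by blast
qed


section \<open>Threads through compact saturated sets\<close>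

text \<open>
  The families to which Zorn's lemma is applied: closed subsystems that meet \<open>Q\<close> at every index.
\<close>

definition closed_family :: "('i \<Rightarrow> 'a set) \<Rightarrow> ('i \<Rightarrow> 'a set) \<Rightarrow> bool" where
  "closed_family Q C \<longleftrightarrow>
     (\<forall>i\<in>I. closedin (X i) (C i) \<and> Q i \<inter> C i \<noteq> {} \<and>
        (\<forall>j\<in>I. le i j \<longrightarrow> p i j ` C j \<subseteq> C i))"

lemma closed_familyD:
  assumes "closed_family Q C" "i \<in> I"
  shows "closedin (X i) (C i)" "Q i \<inter> C i \<noteq> {}"
    "\<And>j x. j \<in> I \<Longrightarrow> le i j \<Longrightarrow> x \<in> C j \<Longrightarrow> p i j x \<in> C i"
  using assms unfolding closed_family_def by blast+

text \<open>
  The intersection of a chain of such families still meets each \<open>Q i\<close> because \<open>Q i\<close> is compact.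
\<close>

lemma minimal_closed_family:
  assumes Q: "\<And>i. i \<in> I \<Longrightarrow> compactin (X i) (Q i)"
    and C: "closed_family Q C"
  obtains M where "closed_family Q M" "\<And>i. i \<in> I \<Longrightarrow> M i \<subseteq> C i"
    "\<And>D i. closed_family Q D \<Longrightarrow> (\<And>j. j \<in> I \<Longrightarrow> D j \<subseteq> M j) \<Longrightarrow> i \<in> I \<Longrightarrow> M i \<subseteq> D i"
proof -
  \<comment> \<open>A family is encoded by the graph of its complements.  Families indexed by \<open>I\<close> then become
     sets, two families that agree on \<open>I\<close> become equal, and a descending chain of families becomes
     an ascending chain of sets, to which Zorn's lemma for inclusion applies.\<close>
  define fam where "fam G i = topspace (X i) - G `` {i}" for G :: "('i \<times> 'a) set" and i
  define A where "A = {G. closed_family Q (fam G) \<and> G \<subseteq> Sigma I (topspace \<circ> X)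
    \<and> (\<forall>i\<in>I. fam G i \<subseteq> C i)}"
  define open_of where "open_of D = Sigma I (\<lambda>i. topspace (X i) - D i)" for D
  have fam_of: "fam (open_of D) i = D i" if "closed_family Q D" "i \<in> I" for D i
    using closedin_subset[OF closed_familyD(1)[OF that]] that(2) unfolding fam_def open_of_def by auto
  have closed_of: "closed_family Q (fam (open_of D))" if "closed_family Q D" for D
    using that fam_of[OF that] unfolding closed_family_def by simp
  have open_of_sub: "open_of D \<subseteq> Sigma I (topspace \<circ> X)" for D
    unfolding open_of_def by auto
  have "open_of C \<in> A"
    unfolding A_def using fam_of[OF C] closed_of[OF C] open_of_sub by auto
  then have ne: "A \<noteq> {}" by blast
  have chain: "\<Union>\<C> \<in> A" if "\<C> \<noteq> {}" and ch: "subset.chain A \<C>" for \<C>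
  proof -
    have sub: "G \<in> A" if "G \<in> \<C>" for G
      using ch that unfolding subset.chain_def by blast
    have lin: "G \<subseteq> H \<or> H \<subseteq> G" if "G \<in> \<C>" "H \<in> \<C>" for G H
      using ch that unfolding subset.chain_def by blast
    have famU: "fam (\<Union>\<C>) i = (\<Inter>G\<in>\<C>. fam G i)" for i
      using \<open>\<C> \<noteq> {}\<close> unfolding fam_def by auto
    have cl: "closedin (X i) (fam G i)" "Q i \<inter> fam G i \<noteq> {}"
      "\<And>j x. j \<in> I \<Longrightarrow> le i j \<Longrightarrow> x \<in> fam G j \<Longrightarrow> p i j x \<in> fam G i"
      if "G \<in> \<C>" "i \<in> I" for G i
      using closed_familyD[of Q "fam G" i] sub[OF that(1)] that(2) unfolding A_def by blast+
    have "closed_family Q (fam (\<Union>\<C>))"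
      unfolding closed_family_def
    proof (intro ballI conjI impI)
      fix i assume i: "i \<in> I"
      show "closedin (X i) (fam (\<Union>\<C>) i)"
        unfolding famU using \<open>\<C> \<noteq> {}\<close> cl(1) i by (intro closedin_Inter) auto
      show "p i j ` fam (\<Union>\<C>) j \<subseteq> fam (\<Union>\<C>) i" if "j \<in> I" "le i j" for j
        unfolding famU using cl(3) i that by blast
      show "Q i \<inter> fam (\<Union>\<C>) i \<noteq> {}"
      proof
        assume em: "Q i \<inter> fam (\<Union>\<C>) i = {}"
        have fip: "\<And>\<U>. (\<forall>C\<in>\<U>. closedin (X i) C) \<Longrightarrow>
          (\<And>\<F>. finite \<F> \<Longrightarrow> \<F> \<subseteq> \<U> \<Longrightarrow> Q i \<inter> \<Inter>\<F> \<noteq> {}) \<Longrightarrow> Q i \<inter> \<Inter>\<U> \<noteq> {}"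
          using Q[OF i] unfolding compactin_fip by blast
        have "Q i \<inter> \<Inter>((\<lambda>G. fam G i) ` \<C>) \<noteq> {}"
        proof (rule fip)
          show "\<forall>C\<in>(\<lambda>G. fam G i) ` \<C>. closedin (X i) C"
            using cl(1) i by blast
          fix \<F> assume F: "finite \<F>" "\<F> \<subseteq> (\<lambda>G. fam G i) ` \<C>"
          show "Q i \<inter> \<Inter>\<F> \<noteq> {}"
          proof (cases "\<F> = {}")
            case True
            then show ?thesis using cl(2) i \<open>\<C> \<noteq> {}\<close> by auto
          next
            case False
            \<comment> \<open>A finite part of a chain has a largest member, so it intersects like a single family.\<close>
            obtain \<G> where G: "\<G> \<subseteq> \<C>" "finite \<G>" "\<F> = (\<lambda>G. fam G i) ` \<G>"
              using finite_subset_image[OF F] by blast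
            then have "\<G> \<noteq> {}" using False by blast
            then have "\<Union>\<G> \<in> \<G>"
              using G lin by (intro Union_in_chain) (auto simp: subset.chain_def)
            then have "fam (\<Union>\<G>) i \<subseteq> \<Inter>\<F>" "\<Union>\<G> \<in> \<C>"
              using G unfolding fam_def by blast+
            then show ?thesis using cl(2) i by blast
          qed
        qed
        then show False using em famU by simp
      qed
    qed
    moreover have "\<Union>\<C> \<subseteq> Sigma I (topspace \<circ> X)"
      using sub unfolding A_def by blast
    moreover have "\<forall>i\<in>I. fam (\<Union>\<C>) i \<subseteq> C i"
      using sub \<open>\<C> \<noteq> {}\<close> unfolding famU A_def by blast
    ultimately show ?thesis unfolding A_def by blast
  qed
  obtain G where G: "G \<in> A" and max: "\<And>H. H \<in> A \<Longrightarrow> G \<subseteq> H \<Longrightarrow> H = G"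
    using subset_Zorn_nonempty[OF ne chain] by blast
  show ?thesis
  proof (rule that[of "fam G"])
    show "closed_family Q (fam G)" using G unfolding A_def by blast
    show "fam G i \<subseteq> C i" if "i \<in> I" for i using G that unfolding A_def by blast
    fix D i assume D: "closed_family Q D" and DG: "\<And>j. j \<in> I \<Longrightarrow> D j \<subseteq> fam G j" and i: "i \<in> I"
    have "open_of D \<in> A"
      using closed_of[OF D] fam_of[OF D] open_of_sub[of D] DG G unfolding A_def
      by (auto, blast)
    moreover have "G \<subseteq> open_of D"
      using G DG unfolding A_def open_of_def fam_def by fastforce
    ultimately have "open_of D = G" using max by blast
    then show "fam G i \<subseteq> D i" using fam_of[OF D i] by blast
  qed
qed

end

locale compact_saturated_sys = projective_sys I le X p
  for I :: "'i set" and le and X :: "'i \<Rightarrow> 'a topology" and p +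
  fixes Q :: "'i \<Rightarrow> 'a set"
  assumes sober: "\<And>i. i \<in> I \<Longrightarrow> sober_space (X i)"
    and Qc: "\<And>i. i \<in> I \<Longrightarrow> compactin (X i) (Q i)"
    and Qs: "\<And>i. i \<in> I \<Longrightarrow> saturated_in (X i) (Q i)"
    and Qp: "\<And>i j x. i \<in> I \<Longrightarrow> j \<in> I \<Longrightarrow> le i j \<Longrightarrow> x \<in> Q j \<Longrightarrow> p i j x \<in> Q i"
begin

text \<open>
  Steenrod's theorem.  The family of generic points of a minimal closed family is the thread.
\<close>

lemma exists_thread:
  assumes C: "closed_family Q C"
  obtains x where "x \<in> topspace Xlim" "\<And>i. i \<in> I \<Longrightarrow> x i \<in> Q i \<inter> C i"
proof -
  obtain M where M: "closed_family Q M" and MC: "\<And>i. i \<in> I \<Longrightarrow> M i \<subseteq> C i"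
    and min: "\<And>D i. closed_family Q D \<Longrightarrow> (\<And>j. j \<in> I \<Longrightarrow> D j \<subseteq> M j) \<Longrightarrow> i \<in> I \<Longrightarrow> M i \<subseteq> D i"
    using minimal_closed_family[OF Qc C] by blast
  note MD = closed_familyD[OF M]
  have Mtop: "M i \<subseteq> topspace (X i)" if "i \<in> I" for i
    using closedin_subset[OF MD(1)[OF that]] .
  \<comment> \<open>The only use of minimality: cutting \<open>M\<close> down to the inverse image of \<open>F\<close> at the indices above
     \<open>i\<close>, and leaving it alone elsewhere, gives a closed family again.  Doing nothing at the other
     indices is harmless because the indices above \<open>i\<close> are upward closed.\<close>
  have restrict: "M i \<subseteq> F"
    if i: "i \<in> I" and F: "closedin (X i) F"
      and meet: "\<And>k. k \<in> I \<Longrightarrow> le i k \<Longrightarrow> \<exists>x\<in>Q k \<inter> M k. p i k x \<in> F" for i F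
  proof -
    define D where "D k = (if le i k then {x \<in> M k. p i k x \<in> F} else M k)" for k
    have "closed_family Q D"
      unfolding closed_family_def
    proof (intro ballI conjI impI)
      fix k assume k: "k \<in> I"
      have "closedin (X k) (M k \<inter> {x \<in> topspace (X k). p i k x \<in> F})" if "le i k"
        using cont[OF i k that] F MD(1)[OF k]
        by (intro closedin_Int closedin_continuous_map_preimage) auto
      moreover have "M k \<inter> {x \<in> topspace (X k). p i k x \<in> F} = {x \<in> M k. p i k x \<in> F}"
        using Mtop[OF k] by blast
      ultimately show "closedin (X k) (D k)"
        using MD(1)[OF k] unfolding D_def by simp
      show "Q k \<inter> D k \<noteq> {}"
        using meet[OF k] MD(2)[OF k] unfolding D_def by auto
      show "p k l ` D l \<subseteq> D k" if l: "l \<in> I" "le k l" for l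
      proof
        fix y assume "y \<in> p k l ` D l"
        then obtain x where x: "x \<in> D l" "y = p k l x" by blast
        then have xM: "x \<in> M l" unfolding D_def by (auto split: if_splits)
        then have yM: "y \<in> M k" using MD(3) k l x by blast
        show "y \<in> D k"
        proof (cases "le i k")
          case True
          then have "le i l" using le_trans i k l by blast
          then have "p i l x \<in> F" using x unfolding D_def by auto
          moreover have "p i k y = p i l x"
            using p_comp[OF i k l(1) True l(2)] xM Mtop[OF l(1)] x by blast
          ultimately show ?thesis using yM True unfolding D_def by simp
        next
          case False
          then show ?thesis using yM unfolding D_def by simp
        qed
      qed
    qed
    then have "M i \<subseteq> D i"
      using min[of D i] i unfolding D_def by auto
    then have "p i i x \<in> F" if "x \<in> M i" for x
      using that le_refl[OF i] unfolding D_def by auto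
    then show "M i \<subseteq> F"
      using p_id[OF i] Mtop[OF i] by fastforce
  qed
  \<comment> \<open>If \<open>M i\<close> lay in neither half of a cover \<open>A \<union> B\<close>, then the inverse image of each half would
     miss \<open>Q \<inter> M\<close> at some index.  At an index beyond both, the inverse image of \<open>A \<union> B\<close> would
     miss \<open>Q \<inter> M\<close>, which is non-empty and is mapped into \<open>M i \<subseteq> A \<union> B\<close>.\<close>
  have irr: "irreducible_closed_in (X i) (M i)" if i: "i \<in> I" for i
    unfolding irreducible_closed_in_def
  proof (intro conjI allI impI)
    show "closedin (X i) (M i)" using MD(1)[OF i] .
    show "M i \<noteq> {}" using MD(2)[OF i] by blast
    fix A B assume AB: "closedin (X i) A \<and> closedin (X i) B \<and> M i \<subseteq> A \<union> B"
    show "M i \<subseteq> A \<or> M i \<subseteq> B"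
    proof (rule ccontr)
      assume "\<not> (M i \<subseteq> A \<or> M i \<subseteq> B)"
      then obtain a b where a: "a \<in> I" "le i a" "\<And>x. x \<in> Q a \<inter> M a \<Longrightarrow> p i a x \<notin> A"
        and b: "b \<in> I" "le i b" "\<And>x. x \<in> Q b \<inter> M b \<Longrightarrow> p i b x \<notin> B"
        using restrict[OF i, of A] restrict[OF i, of B] AB by blast
      obtain k where k: "k \<in> I" "le a k" "le b k"
        using directed a b by blast
      obtain x where x: "x \<in> Q k" "x \<in> M k"
        using MD(2)[OF k(1)] by blast
      have xt: "x \<in> topspace (X k)" using x Mtop k by blast
      have "p i a (p a k x) \<notin> A" "p i b (p b k x) \<notin> B"
        using a b k x Qp MD(3) by blast+
      then have "p i k x \<notin> A \<union> B"
        using p_comp[OF i a(1) k(1) a(2) k(2) xt] p_comp[OF i b(1) k(1) b(2) k(3) xt] by simp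
      moreover have "p i k x \<in> M i"
        using MD(3)[OF i k(1)] le_trans[OF i a(1) k(1) a(2) k(2)] x by blast
      ultimately show False using AB by blast
    qed
  qed
  have "\<exists>x\<in>topspace (X i). M i = X i closure_of {x}" if "i \<in> I" for i
    using sober[OF that] irr[OF that] unfolding sober_space_def by blast
  then obtain g where g: "\<And>i. i \<in> I \<Longrightarrow> g i \<in> topspace (X i)"
      "\<And>i. i \<in> I \<Longrightarrow> M i = X i closure_of {g i}"
    by metis
  have gM: "g i \<in> M i" if "i \<in> I" for i
    using g[OF that] closure_of_subset[of "{g i}" "X i"] by auto
  \<comment> \<open>Some point of \<open>Q i\<close> lies below the generic point.\<close>
  have gQ: "g i \<in> Q i" if i: "i \<in> I" for i
  proof -
    obtain z where "z \<in> Q i" "z \<in> X i closure_of {g i}"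
      using MD(2)[OF i] g(2)[OF i] by blast
    then show ?thesis
      using Qs[OF i] g(1)[OF i] unfolding saturated_in_def spec_le_iff_closure_of by blast
  qed
  \<comment> \<open>\<open>p i j\<close> maps \<open>M j\<close> into the closure of \<open>p i j (g j)\<close>, which therefore, by minimality, contains
     \<open>M i\<close>.  So \<open>p i j (g j)\<close> and \<open>g i\<close> have the same closure.\<close>
  have compat: "p i j (g j) = g i" if ij: "i \<in> I" "j \<in> I" "le i j" for i j
  proof -
    let ?F = "X i closure_of {p i j (g j)}"
    have pt: "p i j (g j) \<in> topspace (X i)"
      using p_in[OF ij g(1)[OF ij(2)]] .
    have im: "p i j y \<in> ?F" if "y \<in> M j" for y
      using that g(2)[OF ij(2)]
        continuous_map_image_closure_subset[OF cont[OF ij], of "{g j}"] by auto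
    have "M i \<subseteq> ?F"
    proof (rule restrict[OF ij(1)])
      show "closedin (X i) ?F" by simp
      fix k assume k: "k \<in> I" "le i k"
      obtain l where l: "l \<in> I" "le j l" "le k l"
        using directed ij k by blast
      obtain y where y: "y \<in> Q l" "y \<in> M l"
        using MD(2)[OF l(1)] by blast
      have yt: "y \<in> topspace (X l)" using y Mtop l by blast
      have "p i k (p k l y) = p i j (p j l y)"
        using p_comp[OF ij(1) k(1) l(1) k(2) l(3) yt] p_comp[OF ij(1,2) l(1) ij(3) l(2) yt] by simp
      moreover have "p i j (p j l y) \<in> ?F"
        using im MD(3)[OF ij(2) l(1,2) y(2)] by blast
      moreover have "p k l y \<in> Q k \<inter> M k"
        using Qp k l y MD(3) by blast
      ultimately show "\<exists>x\<in>Q k \<inter> M k. p i k x \<in> ?F"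
        by (intro bexI[of _ "p k l y"]) simp_all
    qed
    then have 1: "g i \<in> X i closure_of {p i j (g j)}" using gM[OF ij(1)] by blast
    have "p i j (g j) \<in> M i" using MD(3) ij gM by blast
    then have 2: "p i j (g j) \<in> X i closure_of {g i}" using g(2)[OF ij(1)] by blast
    have "t0_space (X i)" using sober[OF ij(1)] unfolding sober_space_def by blast
    then show ?thesis
      using t0_space_closure_of_eq 1 2 by metis
  qed
  show ?thesis
  proof (rule that[of "restrict g I"])
    show "restrict g I \<in> topspace Xlim"
      using g compat unfolding in_limit_iff by simp
    show "restrict g I i \<in> Q i \<inter> C i" if "i \<in> I" for i
      using that gQ gM MC by auto
  qed
qed


definition threads :: "('i \<Rightarrow> 'a) set" where
  "threads = {x \<in> topspace Xlim. \<forall>i\<in>I. x i \<in> Q i}"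

text \<open>
  A monotone family of open sets that catches every thread contains some \<open>Q i\<close>: otherwise the
  complements form a closed family, and \<open>exists_thread\<close> yields a thread that is never caught.
\<close>

lemma eventually_in_open:
  assumes U: "\<And>i. i \<in> I \<Longrightarrow> openin (X i) (U i)"
    and Up: "\<And>i j x. i \<in> I \<Longrightarrow> j \<in> I \<Longrightarrow> le i j \<Longrightarrow> x \<in> topspace (X j) \<Longrightarrow> p i j x \<in> U i
      \<Longrightarrow> x \<in> U j"
    and cover: "\<And>x. x \<in> threads \<Longrightarrow> \<exists>i\<in>I. x i \<in> U i"
  obtains i where "i \<in> I" "Q i \<subseteq> U i"
proof (rule ccontr)
  assume no: "\<not> thesis"
  have Qtop: "Q i \<subseteq> topspace (X i)" if "i \<in> I" for i
    using compactin_subset_topspace[OF Qc[OF that]] .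
  have "closed_family Q (\<lambda>i. topspace (X i) - U i)"
    unfolding closed_family_def
  proof (intro ballI conjI impI)
    fix i assume i: "i \<in> I"
    show "closedin (X i) (topspace (X i) - U i)"
      using U[OF i] by blast
    show "Q i \<inter> (topspace (X i) - U i) \<noteq> {}"
      using no that[OF i] Qtop[OF i] by blast
    show "p i j ` (topspace (X j) - U j) \<subseteq> topspace (X i) - U i" if "j \<in> I" "le i j" for j
      using that Up[OF i that] p_in[OF i that] by blast
  qed
  then obtain x where x: "x \<in> topspace Xlim" "\<And>i. i \<in> I \<Longrightarrow> x i \<in> Q i \<inter> (topspace (X i) - U i)"
    using exists_thread by blast
  then have "x \<in> threads"
    unfolding threads_def by blast
  then obtain i where i: "i \<in> I" "x i \<in> U i"
    using cover by (meson bexE)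
  show False
    using x(2)[OF i(1)] i(2) by simp
qed

text \<open>
  An open cover of the threads induces, through shadows, a monotone family of open sets.  By
  \<open>eventually_in_open\<close> it covers some \<open>Q i\<close>, and the compactness of \<open>Q i\<close> leaves finitely many members.
\<close>

lemma compactin_threads: "compactin Xlim threads"
  unfolding compactin_def
proof (intro conjI allI impI)
  show "threads \<subseteq> topspace Xlim"
    unfolding threads_def by blast
  fix \<U> assume \<U>: "Ball \<U> (openin Xlim) \<and> threads \<subseteq> \<Union>\<U>"
  obtain i where i: "i \<in> I" "Q i \<subseteq> (\<Union>U\<in>\<U>. shadow U i)"
  proof (rule eventually_in_open[of "\<lambda>i. \<Union>U\<in>\<U>. shadow U i"])
    show "openin (X i) (\<Union>U\<in>\<U>. shadow U i)" for i
      using openin_shadow by blast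
    show "x \<in> (\<Union>U\<in>\<U>. shadow U j)"
      if "i \<in> I" "j \<in> I" "le i j" "x \<in> topspace (X j)" "p i j x \<in> (\<Union>U\<in>\<U>. shadow U i)" for i j x
      using that shadow_mono by blast
    show "\<exists>i\<in>I. x i \<in> (\<Union>U\<in>\<U>. shadow U i)" if "x \<in> threads" for x
    proof -
      have "x \<in> \<Union>\<U>" using \<U> that by (rule subsetD[OF conjunct2])
      then obtain U where U: "U \<in> \<U>" "x \<in> U" by (rule UnionE)
      moreover have "openin Xlim U" using conjunct1[OF \<U>] U(1) by (rule bspec)
      ultimately obtain i where "i \<in> I" "x i \<in> shadow U i" using in_shadow by blast
      then show ?thesis using U(1) by blast
    qed
  qed
  obtain \<V> where "finite \<V>" "\<V> \<subseteq> (\<lambda>U. shadow U i) ` \<U>" "Q i \<subseteq> \<Union>\<V>"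
    using compactinD[OF Qc[OF i(1)], of "(\<lambda>U. shadow U i) ` \<U>"] i(2) openin_shadow by auto
  then obtain \<F> where F: "\<F> \<subseteq> \<U>" "finite \<F>" "Q i \<subseteq> (\<Union>U\<in>\<F>. shadow U i)"
    using finite_subset_image by metis
  have "threads \<subseteq> \<Union>\<F>"
    using F(3) i(1) shadow_subset unfolding threads_def by blast
  then show "\<exists>\<F>. finite \<F> \<and> \<F> \<subseteq> \<U> \<and> threads \<subseteq> \<Union>\<F>"
    using F(1,2) by (intro exI[of _ \<F>]) simp
qed

lemma saturated_in_threads: "saturated_in Xlim threads"
  unfolding saturated_in_def
proof (intro conjI ballI allI impI)
  show "threads \<subseteq> topspace Xlim"
    unfolding threads_def by blast
  fix x y assume x: "x \<in> threads" and xy: "spec_le Xlim x y"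
  have "y i \<in> Q i" if "i \<in> I" for i
    using continuous_map_spec_le[OF proj_cont[OF that] xy] Qs[OF that] x that
    unfolding saturated_in_def threads_def by blast
  then show "y \<in> threads"
    using xy unfolding threads_def spec_le_def by blast
qed

text \<open>
  Surjectivity, up to upward closure, of the bonding maps passes to the projections.  By
  \<open>up_closure_subsetI\<close> only open neighbourhoods \<open>V\<close> of the image need to be considered.
\<close>

lemma up_closure_image_threads:
  assumes surj: "\<And>i j. i \<in> I \<Longrightarrow> j \<in> I \<Longrightarrow> le i j \<Longrightarrow> up_closure (X i) (p i j ` Q j) = Q i"
    and i: "i \<in> I"
  shows "up_closure (X i) ((\<lambda>x. x i) ` threads) = Q i"
proof
  have "(\<lambda>x. x i) ` threads \<subseteq> Q i"
    using i unfolding threads_def by blast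
  then show "up_closure (X i) ((\<lambda>x. x i) ` threads) \<subseteq> Q i"
    using up_closure_saturated[OF Qs[OF i]] unfolding up_closure_def by blast
  show "Q i \<subseteq> up_closure (X i) ((\<lambda>x. x i) ` threads)"
  proof (rule up_closure_subsetI)
    show "(\<lambda>x. x i) ` threads \<subseteq> topspace (X i)"
      using limit_in i unfolding threads_def by blast
    show "Q i \<subseteq> topspace (X i)"
      using compactin_subset_topspace[OF Qc[OF i]] .
    fix V assume V: "openin (X i) V" and sub: "(\<lambda>x. x i) ` threads \<subseteq> V"
    \<comment> \<open>Empty unless \<open>j\<close> lies above \<open>i\<close>, which keeps the family monotone on all of \<open>I\<close>.\<close>
    define U where "U j = {x \<in> topspace (X j). le i j \<and> p i j x \<in> V}" for j
    have Up: "x \<in> U k"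
      if "j \<in> I" "k \<in> I" "le j k" "x \<in> topspace (X k)" "p j k x \<in> U j" for j k x
      using that p_comp[OF i that(1,2) _ that(3,4)] le_trans[OF i that(1,2) _ that(3)]
      unfolding U_def by auto
    obtain j where j: "j \<in> I" "Q j \<subseteq> U j"
    proof (rule eventually_in_open[of U])
      show "openin (X j) (U j)" if j: "j \<in> I" for j
      proof (cases "le i j")
        case True
        then show ?thesis
          using openin_continuous_map_preimage[OF cont[OF i j True] V] unfolding U_def by simp
      qed (simp add: U_def)
      show "\<exists>j\<in>I. x j \<in> U j" if "x \<in> threads" for x
      proof
        have x: "x \<in> topspace Xlim" using that unfolding threads_def by blast
        show "x i \<in> U i"
          using sub that limit_in[OF x i] p_id[OF i] le_refl[OF i] unfolding U_def by auto
      qed (rule i)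
    qed (use Up in blast)+
    \<comment> \<open>If \<open>Q j\<close> is empty, \<open>j\<close> need not lie above \<open>i\<close>; passing to \<open>k\<close> covers this case as well.\<close>
    obtain k where k: "k \<in> I" "le i k" "le j k"
      using directed i j by blast
    have "Q k \<subseteq> U k"
      using Up[OF j(1) k(1,3)] Qp[OF j(1) k(1,3)] j(2) compactin_subset_topspace[OF Qc[OF k(1)]]
      by blast
    then have "p i k ` Q k \<subseteq> V"
      unfolding U_def by blast
    then have "up_closure (X i) (p i k ` Q k) \<subseteq> V"
      using V unfolding up_closure_def spec_le_def by blast
    then show "Q i \<subseteq> V"
      using surj[OF i k(1,2)] by simp
  qed
qed

end


section \<open>Lenses of the limit\<close>

context projective_sys
begin

lemma proj_image_subset: "i \<in> I \<Longrightarrow> L \<subseteq> topspace Xlim \<Longrightarrow> (\<lambda>x. x i) ` L \<subseteq> topspace (X i)"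
  using limit_in by blast

text \<open>
  Compactness reduces the cover of \<open>L\<close> by cylinders to a finite one, and directedness to a single
  cylinder.
\<close>

lemma lens_subset_open_iff:
  assumes L: "L \<in> lenses Xlim" and U: "openin Xlim U"
  shows "L \<subseteq> U \<longleftrightarrow> (\<exists>i\<in>I. lens_map (X i) (\<lambda>x. x i) L \<subseteq> shadow U i)"
proof -
  have top: "L \<subseteq> topspace Xlim"
    using lens_subset_topspace[OF L] .
  have "lens_map (X i) (\<lambda>x. x i) L \<subseteq> shadow U i \<longleftrightarrow> (\<forall>x\<in>L. x i \<in> shadow U i)" if "i \<in> I" for i
    using lens_map_subset_iff[OF proj_image_subset[OF that top] openin_shadow] by blast
  moreover have "\<exists>i\<in>I. \<forall>x\<in>L. x i \<in> shadow U i" if sub: "L \<subseteq> U"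
  proof -
    let ?cyl = "\<lambda>i. {x \<in> topspace Xlim. x i \<in> shadow U i}"
    have "L \<subseteq> \<Union>(?cyl ` I)"
    proof
      fix x assume x: "x \<in> L"
      then obtain i where "i \<in> I" "x i \<in> shadow U i"
        using in_shadow[OF U] sub by blast
      then show "x \<in> \<Union>(?cyl ` I)"
        using x top by blast
    qed
    moreover have "openin Xlim V" if "V \<in> ?cyl ` I" for V
      using that openin_cylinder openin_shadow by blast
    ultimately obtain \<V> where "finite \<V>" "\<V> \<subseteq> ?cyl ` I" "L \<subseteq> \<Union>\<V>"
      using compactinD[OF lens_compactin[OF L], of "?cyl ` I"] by blast
    then obtain F where F: "F \<subseteq> I" "finite F" "L \<subseteq> \<Union>(?cyl ` F)"
      using finite_subset_image[of \<V> ?cyl I] by blast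
    obtain k where k: "k \<in> I" "\<forall>i\<in>F. le i k"
      using finite_upper_bound[OF F(2,1)] by blast
    have "x k \<in> shadow U k" if x: "x \<in> L" for x
    proof -
      obtain i where i: "i \<in> F" "x i \<in> shadow U i"
        using F(3) x by blast
      have xt: "x \<in> topspace Xlim" using x top by blast
      have iI: "i \<in> I" "le i k" using i F(1) k(2) by auto
      show ?thesis
        using shadow_mono[OF iI(1) k(1) iI(2) limit_in[OF xt k(1)]]
          limit_compat[OF xt iI(1) k(1) iI(2)] i(2) by simp
    qed
    then show ?thesis using k(1) by blast
  qed
  moreover have "L \<subseteq> U" if "i \<in> I" "\<forall>x\<in>L. x i \<in> shadow U i" for i
    using that shadow_subset top by blast
  ultimately show ?thesis by blast
qed

lemma lens_meets_open_iff:
  assumes L: "L \<in> lenses Xlim" and U: "openin Xlim U"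
  shows "L \<inter> U \<noteq> {} \<longleftrightarrow> (\<exists>i\<in>I. lens_map (X i) (\<lambda>x. x i) L \<inter> shadow U i \<noteq> {})"
proof -
  have top: "L \<subseteq> topspace Xlim"
    using lens_subset_topspace[OF L] .
  have "lens_map (X i) (\<lambda>x. x i) L \<inter> shadow U i \<noteq> {} \<longleftrightarrow> (\<exists>x\<in>L. x i \<in> shadow U i)"
    if "i \<in> I" for i
    using lens_map_meets_iff[OF proj_image_subset[OF that top] openin_shadow, of U] by blast
  moreover have "\<exists>i\<in>I. \<exists>x\<in>L. x i \<in> shadow U i" if ne: "L \<inter> U \<noteq> {}"
  proof -
    obtain x where x: "x \<in> L" "x \<in> U" using ne by blast
    then show ?thesis using in_shadow[OF U x(2)] by blast
  qed
  moreover have "L \<inter> U \<noteq> {}" if "x \<in> L" "x i \<in> shadow U i" for x i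
    using that shadow_subset[of x i U] top by blast
  ultimately show ?thesis by metis
qed

lemma closed_in_limit_iff:
  assumes C: "closedin Xlim C" and x: "x \<in> topspace Xlim"
  shows "x \<in> C \<longleftrightarrow> (\<forall>i\<in>I. x i \<in> X i closure_of ((\<lambda>x. x i) ` C))"
proof
  assume "x \<in> C"
  then show "\<forall>i\<in>I. x i \<in> X i closure_of ((\<lambda>x. x i) ` C)"
    using closure_of_subset[OF proj_image_subset[OF _ closedin_subset[OF C]]] by blast
next
  assume cl: "\<forall>i\<in>I. x i \<in> X i closure_of ((\<lambda>x. x i) ` C)"
  show "x \<in> C"
  proof (rule ccontr)
    assume "x \<notin> C"
    have "openin Xlim (topspace Xlim - C)"
      using C by blast
    then obtain i V where V: "i \<in> I" "openin (X i) V" "x i \<in> V"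
        "{y \<in> topspace Xlim. y i \<in> V} \<subseteq> topspace Xlim - C"
      using limit_basis[of "topspace Xlim - C" x] x \<open>x \<notin> C\<close> by blast
    have "\<exists>y\<in>C. y i \<in> V"
      using cl V(1-3) unfolding in_closure_of by blast
    then show False
      using V(4) closedin_subset[OF C] by blast
  qed
qed

end

text \<open>
  A compatible family of lenses together with a closed set \<open>C\<close> of the limit that induces their
  closures.  The existence of \<open>C\<close> is what the hypothesis on Hoare hyperspaces provides.
\<close>

locale lens_family = projective_sys I le X p
  for I :: "'i set" and le and X :: "'i \<Rightarrow> 'a topology" and p +
  fixes L :: "'i \<Rightarrow> 'a set" and C :: "('i \<Rightarrow> 'a) set"
  assumes sober: "\<And>i. i \<in> I \<Longrightarrow> sober_space (X i)"
    and lens: "\<And>i. i \<in> I \<Longrightarrow> L i \<in> lenses (X i)"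
    and lens_compat: "\<And>i j. i \<in> I \<Longrightarrow> j \<in> I \<Longrightarrow> le i j \<Longrightarrow> lens_map (X i) (p i j) (L j) = L i"
    and closed: "closedin Xlim C"
    and closed_proj: "\<And>i. i \<in> I \<Longrightarrow> X i closure_of ((\<lambda>x. x i) ` C) = X i closure_of (L i)"
begin

lemma lens_top: "i \<in> I \<Longrightarrow> L i \<subseteq> topspace (X i)"
  using lens lens_subset_topspace by blast

lemma p_image: "i \<in> I \<Longrightarrow> j \<in> I \<Longrightarrow> le i j \<Longrightarrow> p i j ` L j \<subseteq> topspace (X i)"
  using p_in lens_top by blast

lemma up_closure_compat:
  assumes "i \<in> I" "j \<in> I" "le i j"
  shows "up_closure (X i) (p i j ` up_closure (X j) (L j)) = up_closure (X i) (L i)"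
  using up_closure_image_up_closure[OF cont[OF assms] lens_top[OF assms(2)]]
    up_closure_lens_map[OF p_image[OF assms]] lens_compat[OF assms] by simp

lemma closure_compat:
  assumes "i \<in> I" "j \<in> I" "le i j"
  shows "X i closure_of (p i j ` (X j closure_of L j)) = X i closure_of L i"
  using closure_of_image_closure_of[OF cont[OF assms] lens_top[OF assms(2)]]
    closure_of_lens_map[OF p_image[OF assms]] lens_compat[OF assms] by simp

sublocale compact_saturated_sys I le X p "\<lambda>i. up_closure (X i) (L i)"
proof
  fix i assume i: "i \<in> I"
  show "sober_space (X i)" using sober i .
  show "compactin (X i) (up_closure (X i) (L i))"
    using compactin_up_closure lens_compactin lens i by blast
  show "saturated_in (X i) (up_closure (X i) (L i))"
    by (rule saturated_in_up_closure)
  fix j x assume j: "j \<in> I" "le i j" and x: "x \<in> up_closure (X j) (L j)"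
  have "p i j ` up_closure (X j) (L j) \<subseteq> topspace (X i)"
    using continuous_map_image_subset_topspace[OF cont[OF i j]] up_closure_subset_topspace
    by (meson image_mono order_trans)
  then show "p i j x \<in> up_closure (X i) (L i)"
    using x up_closure_compat[OF i j] subset_up_closure[of "p i j ` up_closure (X j) (L j)"]
    by blast
qed

text \<open>
  The two conditions on a quasi-lens that ask for points of \<open>threads \<inter> C\<close> are both instances of
  Steenrod's theorem, for the closed sets \<open>cl (L i) \<inter> F i\<close>: with \<open>F i\<close> the whole space for
  non-emptiness, and with \<open>F i\<close> the closure of \<open>x i\<close> for a point below a given thread \<open>x\<close>.
\<close>

lemma lens_threads_below:
  assumes F: "\<And>i. i \<in> I \<Longrightarrow> closedin (X i) (F i)"
    and Fp: "\<And>i j x. i \<in> I \<Longrightarrow> j \<in> I \<Longrightarrow> le i j \<Longrightarrow> x \<in> F j \<Longrightarrow> p i j x \<in> F i"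
    and meet: "\<And>i. i \<in> I \<Longrightarrow> L i \<inter> F i \<noteq> {}"
  obtains y where "y \<in> threads \<inter> C" "\<And>i. i \<in> I \<Longrightarrow> y i \<in> F i"
proof -
  have "closed_family (\<lambda>i. up_closure (X i) (L i)) (\<lambda>i. X i closure_of L i \<inter> F i)"
    unfolding closed_family_def
  proof (intro ballI conjI impI)
    fix i assume i: "i \<in> I"
    show "closedin (X i) (X i closure_of L i \<inter> F i)"
      using F[OF i] by (simp add: closedin_Int)
    show "up_closure (X i) (L i) \<inter> (X i closure_of L i \<inter> F i) \<noteq> {}"
      using meet[OF i] lens_eq[OF lens[OF i]] by blast
    fix j assume j: "j \<in> I" "le i j"
    have "p i j ` (X j closure_of L j) \<subseteq> topspace (X i)"
      using continuous_map_image_subset_topspace[OF cont[OF i j]] closure_of_subset_topspace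
      by (meson image_mono order_trans)
    then have "p i j ` (X j closure_of L j) \<subseteq> X i closure_of L i"
      using closure_compat[OF i j] closure_of_subset[of "p i j ` (X j closure_of L j)"] by blast
    then show "p i j ` (X j closure_of L j \<inter> F j) \<subseteq> X i closure_of L i \<inter> F i"
      using Fp[OF i j] by blast
  qed
  then obtain y where y: "y \<in> topspace Xlim"
      "\<And>i. i \<in> I \<Longrightarrow> y i \<in> up_closure (X i) (L i) \<inter> (X i closure_of L i \<inter> F i)"
    using exists_thread by blast
  then have "y \<in> threads" "y \<in> C"
    unfolding threads_def using closed_in_limit_iff[OF closed y(1)] closed_proj by auto
  then show ?thesis using that y(2) by blast
qed

text \<open>
  The third condition on a quasi-lens does not need a new thread.  If \<open>U\<close> is an open neighbourhood
  of the threads and \<open>V\<close> is an open set meeting \<open>C\<close>, then at a late enough stage \<open>k\<close> the lens \<open>L k\<close>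
  lies in the shadow of \<open>U\<close> and meets the shadow of \<open>V\<close>.  Hence \<open>cl (L k)\<close>, which is the closure of
  the image of \<open>C\<close>, meets the intersection of the two shadows, and so \<open>C\<close> meets \<open>U \<inter> V\<close>.
\<close>

lemma quasi_lens_limit: "(threads, C) \<in> quasi_lenses Xlim"
proof -
  have "threads \<inter> C \<noteq> {}"
  proof -
    obtain y where "y \<in> threads \<inter> C"
    proof (rule lens_threads_below[of "\<lambda>i. topspace (X i)"])
      show "L i \<inter> topspace (X i) \<noteq> {}" if "i \<in> I" for i
        using lens_top[OF that] lens_nonempty[OF lens[OF that]] by blast
    qed (use p_in in auto)
    then show ?thesis by blast
  qed
  moreover have "threads \<subseteq> up_closure Xlim (threads \<inter> C)"
  proof
    fix x assume x: "x \<in> threads"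
    then have xt: "x \<in> topspace Xlim" unfolding threads_def by blast
    obtain y where y: "y \<in> threads \<inter> C" "\<And>i. i \<in> I \<Longrightarrow> y i \<in> X i closure_of {x i}"
    proof (rule lens_threads_below[of "\<lambda>i. X i closure_of {x i}"])
      fix i assume i: "i \<in> I"
      show "closedin (X i) (X i closure_of {x i})" by simp
      have "x i \<in> up_closure (X i) (L i)"
        using x i unfolding threads_def by simp
      then show "L i \<inter> X i closure_of {x i} \<noteq> {}"
        unfolding up_closure_def spec_le_iff_closure_of by auto
      show "p i j z \<in> X i closure_of {x i}"
        if j: "j \<in> I" "le i j" and z: "z \<in> X j closure_of {x j}" for j z
        using continuous_map_image_closure_subset[OF cont[OF i j], of "{x j}"] z
          limit_compat[OF xt i j] by auto
    qed (rule that)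
    have "spec_le Xlim y x"
      unfolding spec_le_def
    proof (intro conjI allI impI)
      show "y \<in> topspace Xlim" using y(1) unfolding threads_def by blast
      fix U assume U: "openin Xlim U \<and> y \<in> U"
      then obtain i V where V: "i \<in> I" "openin (X i) V" "y i \<in> V" "{z \<in> topspace Xlim. z i \<in> V} \<subseteq> U"
        using limit_basis by blast
      then have "x i \<in> V"
        using y(2)[OF V(1)] unfolding in_closure_of by blast
      then show "x \<in> U" using V(4) xt by blast
    qed (rule xt)
    then show "x \<in> up_closure Xlim (threads \<inter> C)"
      using y(1) unfolding up_closure_def by blast
  qed
  moreover have "C \<subseteq> Xlim closure_of (U \<inter> C)" if U: "openin Xlim U" "threads \<subseteq> U" for U
  proof
    fix x assume x: "x \<in> C"
    have Ctop: "C \<subseteq> topspace Xlim" using closedin_subset[OF closed] .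
    obtain i where i: "i \<in> I" "up_closure (X i) (L i) \<subseteq> shadow U i"
    proof (rule eventually_in_open[of "shadow U"])
      show "\<exists>i\<in>I. x i \<in> shadow U i" if "x \<in> threads" for x
        using in_shadow[OF U(1)] U(2) that by blast
    qed (use openin_shadow shadow_mono in auto)
    show "x \<in> Xlim closure_of (U \<inter> C)"
      unfolding in_closure_of
    proof (intro conjI allI impI)
      show "x \<in> topspace Xlim" using x Ctop by blast
      fix V assume V: "x \<in> V \<and> openin Xlim V"
      then obtain j where j: "j \<in> I" "x j \<in> shadow V j"
        using in_shadow by blast
      obtain k where k: "k \<in> I" "le i k" "le j k"
        using directed i j by blast
      have xt: "x \<in> topspace Xlim" using x Ctop by blast
      have xk: "x k \<in> shadow V k"
        using shadow_mono[OF j(1) k(1,3) limit_in[OF xt k(1)]] limit_compat[OF xt j(1) k(1,3)] j(2)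
        by simp
      have "L k \<subseteq> shadow U k"
      proof
        fix z assume z: "z \<in> L k"
        then have zt: "z \<in> topspace (X k)" using lens_top k(1) by blast
        have "z \<in> up_closure (X k) (L k)"
          using z subset_up_closure[OF lens_top[OF k(1)]] by blast
        then have "p i k z \<in> shadow U i"
          using Qp[OF i(1) k(1,2)] i(2) by blast
        then show "z \<in> shadow U k"
          using shadow_mono[OF i(1) k(1,2) zt] by blast
      qed
      moreover have "\<exists>z\<in>L k. z \<in> shadow V k"
      proof -
        have "x k \<in> X k closure_of L k"
          using closed_in_limit_iff[OF closed xt] x closed_proj k(1) by blast
        then show ?thesis
          using xk openin_shadow unfolding in_closure_of by blast
      qed
      ultimately obtain z where z: "z \<in> L k" "z \<in> shadow U k" "z \<in> shadow V k"
        by blast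
      have "z \<in> X k closure_of ((\<lambda>x. x k) ` C)"
        using z(1) closed_proj[OF k(1)] closure_of_subset[OF lens_top[OF k(1)]] by blast
      moreover have "openin (X k) (shadow U k \<inter> shadow V k)"
        by (intro openin_Int openin_shadow)
      ultimately obtain y where "y \<in> C" "y k \<in> shadow U k" "y k \<in> shadow V k"
        using z unfolding in_closure_of by blast
      then have "y \<in> U \<inter> C" "y \<in> V"
        using shadow_subset Ctop by blast+
      then show "\<exists>y. y \<in> U \<inter> C \<and> y \<in> V" by blast
    qed
  qed
  ultimately show ?thesis
    unfolding quasi_lenses_def using compactin_threads saturated_in_threads closed by blast
qed

lemma lens_map_limit:
  assumes M: "M \<in> lenses Xlim" and qM: "lens_to_quasi_lens Xlim M = (threads, C)"
    and i: "i \<in> I"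
  shows "lens_map (X i) (\<lambda>x. x i) M = L i"
proof -
  have top: "M \<subseteq> topspace Xlim" using lens_subset_topspace[OF M] .
  have eq: "up_closure Xlim M = threads" "Xlim closure_of M = C"
    using qM unfolding lens_to_quasi_lens_def by auto
  have "up_closure (X i) ((\<lambda>x. x i) ` M) = up_closure (X i) (L i)"
    using up_closure_image_up_closure[OF proj_cont[OF i] top]
      up_closure_image_threads[OF up_closure_compat i] eq by simp
  moreover have "X i closure_of ((\<lambda>x. x i) ` M) = X i closure_of (L i)"
    using closure_of_image_closure_of[OF proj_cont[OF i] top] closed_proj[OF i] eq by simp
  ultimately show ?thesis
    using lens_eq[OF lens[OF i]] unfolding lens_map_def by simp
qed

end


section \<open>The space of lenses of a projective limit\<close>

theorem theorem9p11:
  fixes I :: "'i set"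
    and le :: "'i \<Rightarrow> 'i \<Rightarrow> bool"
    and X :: "'i \<Rightarrow> 'a topology"
    and p :: "'i \<Rightarrow> 'i \<Rightarrow> 'a \<Rightarrow> 'a"
  defines "Xlim \<equiv> projective_limit I le X p"
  assumes "projective_system I le X p"
    and "\<And>i. i \<in> I \<Longrightarrow> sober_space (X i)"
    and "lens_to_quasi_lens Xlim ` topspace (lens_space Xlim) = topspace (quasi_lens_space Xlim)"
    and "is_projective_limit I le
           (\<lambda>i. hoare_space (X i)) (\<lambda>i j. hoare_map (X i) (p i j))
           (hoare_space Xlim) (\<lambda>i. hoare_map (X i) (\<lambda>x. x i))"
  shows "is_projective_limit I le
           (\<lambda>i. lens_space (X i)) (\<lambda>i j. lens_map (X i) (p i j))
           (lens_space Xlim) (\<lambda>i. lens_map (X i) (\<lambda>x. x i))"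
proof -
  interpret S: projective_sys I le X p
    by unfold_locales (rule assms(2))
  interpret H: projective_sys I le "\<lambda>i. hoare_space (X i)" "\<lambda>i j. hoare_map (X i) (p i j)"
    by unfold_locales (rule projective_system_hoare_space[OF assms(2)])
  interpret P: projective_sys I le "\<lambda>i. lens_space (X i)" "\<lambda>i j. lens_map (X i) (p i j)"
    by unfold_locales (rule projective_system_lens_space[OF assms(2)])
  let ?Z = "projective_limit I le (\<lambda>i. lens_space (X i)) (\<lambda>i j. lens_map (X i) (p i j))"
  define f where "f L = (\<lambda>i\<in>I. lens_map (X i) (\<lambda>x. x i) L)" for L
  have f_in: "f L \<in> topspace ?Z" if L: "L \<in> lenses Xlim" for L
    unfolding P.in_limit_iff
  proof (intro conjI ballI impI)
    show "f L \<in> extensional I" unfolding f_def by simp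
    fix i assume i: "i \<in> I"
    show "f L i \<in> topspace (lens_space (X i))"
      using lens_map_in[OF S.proj_cont[OF i]] L i unfolding f_def topspace_lens_space Xlim_def by simp
    fix j assume j: "j \<in> I" "le i j"
    have L': "L \<in> lenses S.Xlim" using L unfolding Xlim_def .
    have "(p i j \<circ> (\<lambda>x. x j)) ` L = (\<lambda>x. x i) ` L"
      using S.limit_compat[OF _ i j] lens_subset_topspace[OF L'] by (intro image_cong refl) auto
    then show "lens_map (X i) (p i j) (f L j) = f L i"
      using lens_map_comp[OF S.proj_cont[OF j(1)] S.cont[OF i j] L'] i j
      unfolding f_def lens_map_def by simp
  qed
  have surj: "\<exists>M\<in>lenses Xlim. f M = y" if y: "y \<in> topspace ?Z" for y
  proof -
    have lens: "y i \<in> lenses (X i)" if "i \<in> I" for i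
      using P.limit_in[OF y that] by (simp add: topspace_lens_space)
    have compat: "lens_map (X i) (p i j) (y j) = y i" if "i \<in> I" "j \<in> I" "le i j" for i j
      using P.limit_compat[OF y that] .
    have "(\<lambda>i\<in>I. X i closure_of (y i)) \<in> topspace H.Xlim"
      unfolding H.in_limit_iff
    proof (intro conjI ballI impI)
      show "(\<lambda>i\<in>I. X i closure_of (y i)) \<in> extensional I" by simp
      fix i assume i: "i \<in> I"
      show "(\<lambda>i\<in>I. X i closure_of (y i)) i \<in> topspace (hoare_space (X i))"
        using i lens_nonempty[OF lens[OF i]] closure_of_subset[OF lens_subset_topspace[OF lens[OF i]]]
        by (auto simp: topspace_hoare_space)
      fix j assume j: "j \<in> I" "le i j"
      have top: "y j \<subseteq> topspace (X j)" using lens_subset_topspace[OF lens[OF j(1)]] .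
      then have "p i j ` y j \<subseteq> topspace (X i)" using S.p_in[OF i j] by blast
      then have "hoare_map (X i) (p i j) (X j closure_of y j) = X i closure_of y i"
        unfolding hoare_map_def closure_of_image_closure_of[OF S.cont[OF i j] top]
        by (metis closure_of_lens_map compat[OF i j])
      then show "hoare_map (X i) (p i j) ((\<lambda>i\<in>I. X i closure_of (y i)) j) =
          (\<lambda>i\<in>I. X i closure_of (y i)) i"
        using i j by simp
    qed
    moreover have "topspace H.Xlim =
        (\<lambda>C. \<lambda>i\<in>I. hoare_map (X i) (\<lambda>x. x i) C) ` topspace (hoare_space Xlim)"
      using assms(5) unfolding is_projective_limit_def
      by (simp add: homeomorphic_imp_surjective_map)
    ultimately obtain C where C: "C \<in> topspace (hoare_space Xlim)"
      and eq: "(\<lambda>i\<in>I. X i closure_of (y i)) = (\<lambda>i\<in>I. hoare_map (X i) (\<lambda>x. x i) C)"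
      by auto
    have proj: "X i closure_of ((\<lambda>x. x i) ` C) = X i closure_of (y i)" if "i \<in> I" for i
      using fun_cong[OF eq, of i] that unfolding hoare_map_def by simp
    have closed: "closedin S.Xlim C"
      using C unfolding topspace_hoare_space Xlim_def by simp
    interpret F: lens_family I le X p y C
    proof
      show "sober_space (X i)" if "i \<in> I" for i using assms(3)[OF that] .
      show "y i \<in> lenses (X i)" if "i \<in> I" for i using lens[OF that] .
      show "lens_map (X i) (p i j) (y j) = y i" if "i \<in> I" "j \<in> I" "le i j" for i j
        using compat[OF that] .
      show "closedin S.Xlim C" by (rule closed)
      show "X i closure_of ((\<lambda>x. x i) ` C) = X i closure_of (y i)" if "i \<in> I" for i
        using proj[OF that] .
    qed
    have "(F.threads, C) \<in> lens_to_quasi_lens Xlim ` lenses Xlim"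
      using F.quasi_lens_limit assms(4)
      unfolding topspace_lens_space topspace_quasi_lens_space Xlim_def by simp
    then obtain M where M: "M \<in> lenses Xlim" "lens_to_quasi_lens Xlim M = (F.threads, C)"
      by (elim imageE) simp
    have "f M = y"
    proof (rule extensionalityI[of _ I])
      show "f M \<in> extensional I" unfolding f_def by simp
      show "y \<in> extensional I" using y P.in_limit_iff by simp
      show "f M i = y i" if "i \<in> I" for i
        using F.lens_map_limit[OF _ _ that] M that unfolding f_def Xlim_def by simp
    qed
    then show ?thesis using M(1) by blast
  qed
  have box: "L \<subseteq> U \<longleftrightarrow> (\<exists>i\<in>I. f L i \<subseteq> S.shadow U i)"
    and dia: "L \<inter> U \<noteq> {} \<longleftrightarrow> (\<exists>i\<in>I. f L i \<inter> S.shadow U i \<noteq> {})"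
    if "L \<in> lenses Xlim" "openin Xlim U" for L U
    using S.lens_subset_open_iff[of L U] S.lens_meets_open_iff[of L U] that
    unfolding f_def Xlim_def by auto
  have bij: "bij_betw f (topspace (lens_space Xlim)) (topspace ?Z)"
    unfolding bij_betw_def topspace_lens_space
  proof
    have "L \<subseteq> M" if "L \<in> lenses Xlim" "M \<in> lenses Xlim" "f L = f M" for L M
      using that by (intro lens_subsetI[of M Xlim L]) (simp_all add: box dia)
    then show "inj_on f (lenses Xlim)"
      by (intro inj_onI subset_antisym) simp_all
    show "f ` lenses Xlim = topspace ?Z"
      using f_in surj by blast
  qed
  have cont: "continuous_map (lens_space Xlim) ?Z f"
    unfolding projective_limit_def continuous_map_in_subtopology
  proof
    show "continuous_map (lens_space Xlim) (product_topology (\<lambda>i. lens_space (X i)) I) f"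
      unfolding continuous_map_componentwise f_def
      using continuous_map_lens_map[OF S.proj_cont] unfolding Xlim_def by auto
    show "f \<in> topspace (lens_space Xlim) \<rightarrow>
        {x. \<forall>i\<in>I. \<forall>j\<in>I. le i j \<longrightarrow> lens_map (X i) (p i j) (x j) = x i}"
    proof (intro Pi_I CollectI)
      fix L assume "L \<in> topspace (lens_space Xlim)"
      then have "f L \<in> topspace ?Z" using f_in by (simp add: topspace_lens_space)
      then show "\<forall>i\<in>I. \<forall>j\<in>I. le i j \<longrightarrow> lens_map (X i) (p i j) (f L j) = f L i"
        unfolding P.in_limit_iff by (elim conjE)
    qed
  qed
  \<comment> \<open>A property of lenses that is detected at some stage by an open property has open image.\<close>
  have image_open: "openin ?Z (f ` {L \<in> lenses Xlim. P L})"
    if PR: "\<And>L. L \<in> lenses Xlim \<Longrightarrow> P L \<longleftrightarrow> (\<exists>i\<in>I. R i (f L i))"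
      and R: "\<And>i. i \<in> I \<Longrightarrow> openin (lens_space (X i)) {L \<in> lenses (X i). R i L}" for P R
  proof -
    have "f ` {L \<in> lenses Xlim. P L} =
        (\<Union>i\<in>I. {y \<in> topspace ?Z. y i \<in> {L \<in> lenses (X i). R i L}})"
    proof (intro subset_antisym subsetI)
      fix y assume "y \<in> f ` {L \<in> lenses Xlim. P L}"
      then obtain L where L: "L \<in> lenses Xlim" "P L" "y = f L" by auto
      then obtain i where i: "i \<in> I" "R i (y i)" using PR by auto
      have "y \<in> topspace ?Z" using f_in L by simp
      moreover from this have "y i \<in> lenses (X i)"
        using P.limit_in[OF _ i(1)] by (simp add: topspace_lens_space)
      ultimately show "y \<in> (\<Union>i\<in>I. {y \<in> topspace ?Z. y i \<in> {L \<in> lenses (X i). R i L}})"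
        using i by auto
    next
      fix y assume "y \<in> (\<Union>i\<in>I. {y \<in> topspace ?Z. y i \<in> {L \<in> lenses (X i). R i L}})"
      then obtain i where i: "i \<in> I" "y \<in> topspace ?Z" "R i (y i)" by auto
      then obtain M where M: "M \<in> lenses Xlim" "f M = y" using surj by auto
      then have "P M" using PR i by auto
      then show "y \<in> f ` {L \<in> lenses Xlim. P L}" using M by auto
    qed
    moreover have "openin ?Z (\<Union>i\<in>I. {y \<in> topspace ?Z. y i \<in> {L \<in> lenses (X i). R i L}})"
      using P.openin_cylinder R by (intro openin_Union) fast
    ultimately show ?thesis by simp
  qed
  have box_open: "openin ?Z (f ` {L \<in> lenses Xlim. L \<subseteq> U})" if U: "openin Xlim U" for U
    using box[OF _ U]
  proof (rule image_open)
    show "openin (lens_space (X i)) {L \<in> lenses (X i). L \<subseteq> S.shadow U i}" for i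
      by (intro openin_lens_box S.openin_shadow)
  qed
  have dia_open: "openin ?Z (f ` {L \<in> lenses Xlim. L \<inter> U \<noteq> {}})" if U: "openin Xlim U" for U
    using dia[OF _ U]
  proof (rule image_open)
    show "openin (lens_space (X i)) {L \<in> lenses (X i). L \<inter> S.shadow U i \<noteq> {}}" for i
      by (intro openin_lens_meets S.openin_shadow)
  qed
  have "homeomorphic_map (lens_space Xlim) ?Z f"
  proof (rule homeomorphic_map_generated[OF lens_space_def cont bij])
    fix s assume "s \<in> {{L \<in> lenses Xlim. L \<subseteq> U} |U. openin Xlim U} \<union>
        {{L \<in> lenses Xlim. L \<inter> U \<noteq> {}} |U. openin Xlim U}"
    then show "openin ?Z (f ` s)"
      by (elim UnE CollectE exE conjE) (simp_all only: box_open dia_open)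
  qed
  then show ?thesis
    unfolding is_projective_limit_def f_def .
qed

end
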